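(* Let $k\geq 2$ be an integer and let $\Gamma$ be a finite $k$-regular graph. Then the energy per vertex $\mathcal{E}(\Gamma)$ of $\Gamma$ satisfies $$\mathcal{E}(\Gamma)\leq \frac{k+(k^2-k)\sqrt{k-1}}{k^2-k+1},$$ with equality if and only if $\Gamma$ is the disjoint union of incidence graphs of projective planes of order $k-1$ or, in case $k=2$, $\Gamma$ is the disjoint union of triangles and hexagons. *)

theory Defs
  imports
    "Graph_Theory.Graph_Theory"
    "Jordan_Normal_Form.Spectral_Radius"
    "HOL-Library.Disjoint_Sets"
begin

text \<open>
  A finite simple undirected graph is a \<^locale>\<open>pair_graph\<close>: a finite vertex set together with a
  symmetric, irreflexive set of ordered pairs, each edge being represented by its two orientations.
  Hence the degree of a vertex is its out-degree.
\<close>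

definition k_regular :: "nat \<Rightarrow> 'a pair_pre_digraph \<Rightarrow> bool" where
  "k_regular k G \<longleftrightarrow> (\<forall>v \<in> pverts G. out_degree (with_proj G) v = k)"

definition adjacency_matrix :: "'a pair_pre_digraph \<Rightarrow> 'a list \<Rightarrow> complex mat" where
  "adjacency_matrix G vs =
     mat (length vs) (length vs) (\<lambda>(i, j). if (vs ! i, vs ! j) \<in> parcs G then 1 else 0)"

text \<open>
  Different enumerations of the vertices give similar adjacency matrices, so the choice of
  enumeration below is immaterial. Eigenvalues are counted with algebraic multiplicity.
\<close>

definition energy :: "'a pair_pre_digraph \<Rightarrow> real" where
  "energy G =
     (let A = adjacency_matrix G (SOME vs. distinct vs \<and> set vs = pverts G)
      in \<Sum>\<mu> \<in> spectrum A. real (Polynomial.order \<mu> (char_poly A)) * cmod \<mu>)"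

definition energy_per_vertex :: "'a pair_pre_digraph \<Rightarrow> real" where
  "energy_per_vertex G = energy G / real (card (pverts G))"

definition disjoint_union_of ::
  "('a pair_pre_digraph \<Rightarrow> bool) \<Rightarrow> 'a pair_pre_digraph \<Rightarrow> bool" where
  "disjoint_union_of Q G \<longleftrightarrow>
     (\<exists>\<C>. (\<forall>H \<in> \<C>. Q H) \<and> disjoint_family_on pverts \<C> \<and>
          pverts G = (\<Union>H \<in> \<C>. pverts H) \<and> parcs G = (\<Union>H \<in> \<C>. parcs H))"

definition projective_plane :: "'p set \<Rightarrow> 'l set \<Rightarrow> ('p \<times> 'l) set \<Rightarrow> bool" where
  "projective_plane P L I \<longleftrightarrow>
     I \<subseteq> P \<times> L \<and>
     (\<forall>p \<in> P. \<forall>q \<in> P. p \<noteq> q \<longrightarrow> (\<exists>!l. l \<in> L \<and> (p, l) \<in> I \<and> (q, l) \<in> I)) \<and>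
     (\<forall>l \<in> L. \<forall>m \<in> L. l \<noteq> m \<longrightarrow> (\<exists>!p. p \<in> P \<and> (p, l) \<in> I \<and> (p, m) \<in> I)) \<and>
     (\<exists>Q \<subseteq> P. card Q = 4 \<and> (\<forall>l \<in> L. card {p \<in> Q. (p, l) \<in> I} \<le> 2))"

definition projective_plane_of_order ::
  "nat \<Rightarrow> 'p set \<Rightarrow> 'l set \<Rightarrow> ('p \<times> 'l) set \<Rightarrow> bool" where
  "projective_plane_of_order n P L I \<longleftrightarrow>
     projective_plane P L I \<and> (\<forall>l \<in> L. card {p \<in> P. (p, l) \<in> I} = n + 1)"

definition incidence_graph ::
  "'p set \<Rightarrow> 'l set \<Rightarrow> ('p \<times> 'l) set \<Rightarrow> ('p + 'l) pair_pre_digraph" where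
  "incidence_graph P L I =
     \<lparr> pverts = P <+> L,
       parcs = {(Inl p, Inr l) | p l. (p, l) \<in> I} \<union> {(Inr l, Inl p) | p l. (p, l) \<in> I} \<rparr>"

text \<open>
  The points and lines may be taken from the vertex type of \<open>H\<close> without loss of generality: an
  isomorphism of \<open>H\<close> with an incidence graph transports the plane to the vertices of \<open>H\<close>.
\<close>

definition is_projective_plane_incidence_graph :: "nat \<Rightarrow> 'a pair_pre_digraph \<Rightarrow> bool" where
  "is_projective_plane_incidence_graph n H \<longleftrightarrow>
     (\<exists>(P :: 'a set) (L :: 'a set) I.
        projective_plane_of_order n P L I \<and>
        digraph_iso (with_proj H) (with_proj (incidence_graph P L I)))"

definition cycle_graph :: "nat \<Rightarrow> nat pair_pre_digraph" where
  "cycle_graph n =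
     \<lparr> pverts = {..<n},
       parcs = {(i, j). i < n \<and> j < n \<and> (j = (i + 1) mod n \<or> i = (j + 1) mod n)} \<rparr>"

definition is_triangle :: "'a pair_pre_digraph \<Rightarrow> bool" where
  "is_triangle H \<longleftrightarrow> digraph_iso (with_proj H) (with_proj (cycle_graph 3))"

definition is_hexagon :: "'a pair_pre_digraph \<Rightarrow> bool" where
  "is_hexagon H \<longleftrightarrow> digraph_iso (with_proj H) (with_proj (cycle_graph 6))"

end

theory Submission
  imports Defs
begin

text \<open>
  Let \<open>s = sqrt (k - 1)\<close>. The quartic \<open>(\<bar>x\<bar> - s)\<^sup>2 * (k - \<bar>x\<bar>) * (\<bar>x\<bar> + 2 * s + k)\<close> has no cubic term
  and is nonnegative at every eigenvalue. Summed over the spectrum it involves only \<open>n\<close>, the energy, and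
  the traces of \<open>A\<^sup>2\<close> and \<open>A\<^sup>4\<close>. The former is \<open>n * k\<close> and the latter is at least \<open>n * k * (2 * k - 1)\<close>, with
  equality iff there are no 4-cycles; this gives the bound.

  Equality means that there are no 4-cycles and that all eigenvalues are \<open>\<plusminus>k\<close> or \<open>\<plusminus>s\<close>. Then
  \<open>N = A\<^sup>2 - s\<^sup>2 * I\<close> is the 0-1 matrix of the relation ``equal or having a common neighbour'', and the
  eigenvalue condition becomes \<open>N\<^sup>2 = (k\<^sup>2 - k + 1) * N\<close>, that is, transitivity of this relation. A class of
  the relation and the class of its neighbours form a component. If the two classes differ, they are the
  points and lines of a projective plane (of a triangle, if \<open>k = 2\<close>). If they coincide, the component is a
  regular graph in which any two vertices have exactly one common neighbour, and comparing the traces of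
  \<open>A\<close> and \<open>A\<^sup>3\<close> leaves only the triangle.
\<close>

section \<open>Traces and spectra of Hermitian matrices\<close>

text \<open>\<open>X\<close> is a polynomial in \<open>A\<close>, and \<open>f\<close> is the
  function of the same polynomial on scalars. Generating both together lets statements about
  eigenvalues go by rule induction, without evaluating polynomials at matrices.\<close>

inductive mat_poly :: "complex mat \<Rightarrow> complex mat \<Rightarrow> (complex \<Rightarrow> complex) \<Rightarrow> bool"
  for A where
  one: "mat_poly A (1\<^sub>m (dim_row A)) (\<lambda>_. 1)"
| self: "mat_poly A A (\<lambda>x. x)"
| add: "mat_poly A X f \<Longrightarrow> mat_poly A Y g \<Longrightarrow> mat_poly A (X + Y) (\<lambda>x. f x + g x)"
| smult: "mat_poly A X f \<Longrightarrow> mat_poly A (c \<cdot>\<^sub>m X) (\<lambda>x. c * f x)"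
| mult: "mat_poly A X f \<Longrightarrow> mat_poly A Y g \<Longrightarrow> mat_poly A (X * Y) (\<lambda>x. f x * g x)"

lemma mat_poly_carrier:
  assumes "mat_poly A X f" "A \<in> carrier_mat n n"
  shows "X \<in> carrier_mat n n"
  using assms by (induction rule: mat_poly.induct) auto

text \<open>A nonzero term of the product at \<open>(i, j)\<close> needs \<open>i\<close> \<le>
  \<open>l\<close> \<le> \<open>j\<close>. Below the diagonal there is no such \<open>l\<close>, and
  on it only \<open>l = i\<close>.\<close>

lemma upper_triangular_mult:
  fixes A B :: "'a :: semiring_0 mat"
  assumes "A \<in> carrier_mat n n" "B \<in> carrier_mat n n"
    and "upper_triangular A" "upper_triangular B"
  shows "upper_triangular (A * B)"
    and "\<And>i. i < n \<Longrightarrow> (A * B) $$ (i, i) = A $$ (i, i) * B $$ (i, i)"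
proof -
  have entry: "(A * B) $$ (i, j) = (\<Sum>l<n. A $$ (i, l) * B $$ (l, j))" if "i < n" "j < n" for i j
    using that assms(1,2) by (simp add: scalar_prod_def lessThan_atLeast0)
  have zero: "A $$ (i, l) * B $$ (l, j) = 0" if "i < n" "l < n" "l < i \<or> j < l" for i j l
    using that assms upper_triangularD[of A l i] upper_triangularD[of B j l] by auto
  show "upper_triangular (A * B)"
  proof (rule upper_triangularI)
    fix i j assume "j < i" "i < dim_row (A * B)"
    hence ij: "j < i" "i < n" using assms(1) by auto
    have "(\<Sum>l<n. A $$ (i, l) * B $$ (l, j)) = 0"
      using ij by (intro sum.neutral ballI zero) auto
    thus "(A * B) $$ (i, j) = 0" using entry ij by simp
  qed
  fix i assume i: "i < n"
  have "(\<Sum>l<n. A $$ (i, l) * B $$ (l, i)) = (\<Sum>l\<in>{i}. A $$ (i, l) * B $$ (l, i))"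
    using i by (intro sum.mono_neutral_right) (auto intro!: zero simp: neq_iff)
  thus "(A * B) $$ (i, i) = A $$ (i, i) * B $$ (i, i)" using entry i by simp
qed

text \<open>Conjugation is multiplicative because the inner \<open>P * Q\<close> cancels, and so is
  reading off a diagonal entry of upper triangular matrices. Hence one change of basis
  triangularises every polynomial in \<open>A\<close>, with \<open>f\<close> applied to the
  diagonal.\<close>

lemma mat_poly_triangular:
  assumes "mat_poly A X f" "A \<in> carrier_mat n n"
    and PQ: "P \<in> carrier_mat n n" "Q \<in> carrier_mat n n" "P * Q = 1\<^sub>m n" "Q * P = 1\<^sub>m n"
    and A: "upper_triangular (Q * A * P)"
  shows "upper_triangular (Q * X * P) \<and>
         (\<forall>i<n. (Q * X * P) $$ (i, i) = f ((Q * A * P) $$ (i, i)))"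
  using assms(1)
proof (induction rule: mat_poly.induct)
  case one
  then show ?case using assms(2) PQ by auto
next
  case self
  then show ?case using A by auto
next
  case (add X f Y g)
  hence c: "X \<in> carrier_mat n n" "Y \<in> carrier_mat n n" using mat_poly_carrier assms(2) by auto
  have "Q * (X + Y) * P = Q * X * P + Q * Y * P"
    using PQ(1,2) c by (simp add: mult_add_distrib_mat[of _ n n] add_mult_distrib_mat[of _ n n])
  then show ?case using add.IH PQ(1,2) c by (auto simp: upper_triangular_def)
next
  case (smult X f a)
  hence c: "X \<in> carrier_mat n n" using mat_poly_carrier assms(2) by auto
  have "Q * (a \<cdot>\<^sub>m X) * P = a \<cdot>\<^sub>m (Q * X * P)"
    using PQ(1,2) c by (simp add: mult_smult_distrib[of _ n n _ n] mult_smult_assoc_mat[of _ n n _ n])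
  then show ?case using smult.IH PQ(1,2) c by (auto simp: upper_triangular_def)
next
  case (mult X f Y g)
  hence c: "X \<in> carrier_mat n n" "Y \<in> carrier_mat n n" using mat_poly_carrier assms(2) by auto
  have "(Q * X * P) * (Q * Y * P) = Q * X * (P * Q) * (Y * P)"
    using PQ(1,2) c by (simp add: assoc_mult_mat[of _ n n _ n _ n])
  also have "\<dots> = Q * (X * Y) * P"
    using PQ c by (simp add: assoc_mult_mat[of _ n n _ n _ n])
  finally have eq: "Q * (X * Y) * P = (Q * X * P) * (Q * Y * P)" ..
  show ?case unfolding eq
    using upper_triangular_mult[of "Q * X * P" n "Q * Y * P"] mult.IH PQ(1,2) c by auto
qed

lemma trace_mult_commute:
  fixes A B :: "'a :: comm_semiring_0 mat"
  assumes "A \<in> carrier_mat n n" "B \<in> carrier_mat n n"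
  shows "(\<Sum>i<n. (A * B) $$ (i, i)) = (\<Sum>i<n. (B * A) $$ (i, i))"
proof -
  have "(\<Sum>i<n. (A * B) $$ (i, i)) = (\<Sum>i<n. \<Sum>j<n. A $$ (i, j) * B $$ (j, i))"
    using assms by (simp add: scalar_prod_def lessThan_atLeast0)
  also have "\<dots> = (\<Sum>j<n. \<Sum>i<n. B $$ (j, i) * A $$ (i, j))"
    by (subst sum.swap) (simp add: mult.commute)
  also have "\<dots> = (\<Sum>i<n. (B * A) $$ (i, i))"
    using assms by (simp add: scalar_prod_def lessThan_atLeast0)
  finally show ?thesis .
qed

text \<open>A Schur decomposition puts \<open>es\<close> on the diagonal of a triangular form of
  \<open>A\<close>. The same basis puts the values \<open>f e\<close> on the diagonal for
  \<open>X\<close>, and the trace does not depend on the basis.\<close>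

lemma trace_mat_poly:
  assumes A: "A \<in> carrier_mat n n"
    and es: "char_poly A = (\<Prod>e\<leftarrow>es. [:- e, 1:])"
    and X: "mat_poly A X f"
  shows "(\<Sum>i<n. X $$ (i, i)) = (\<Sum>e\<leftarrow>es. f e)"
proof -
  obtain B P Q where sch: "schur_decomposition A es = (B, P, Q)"
    by (cases "schur_decomposition A es")
  from schur_decomposition[OF A es sch]
  have sim: "similar_mat_wit A B P Q" and ut: "upper_triangular B" and diag: "diag_mat B = es"
    by auto
  note w = similar_mat_witD2[OF A sim]
  have "Q * A * P = (Q * P) * B * (Q * P)"
    using w(5-7) unfolding w(3) by (simp add: assoc_mult_mat[of _ n n _ n _ n])
  hence B: "Q * A * P = B" using w by simp
  have c: "X \<in> carrier_mat n n" by (rule mat_poly_carrier[OF X A])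
  have tri: "\<forall>i<n. (Q * X * P) $$ (i, i) = f (B $$ (i, i))"
    using mat_poly_triangular[OF X A w(6,7,1,2)] ut unfolding B by simp
  \<comment> \<open>A cyclic shift of the factors turns the trace of \<open>X\<close> into that of
    \<open>Q * X * P\<close>.\<close>
  have "X = P * (Q * X)" using assoc_mult_mat[of P n n Q n X n] w(1,6,7) c by simp
  hence "(\<Sum>i<n. X $$ (i, i)) = (\<Sum>i<n. (P * (Q * X)) $$ (i, i))" by simp
  also have "\<dots> = (\<Sum>i<n. (Q * X * P) $$ (i, i))"
    using w c by (intro trace_mult_commute) auto
  also have "\<dots> = (\<Sum>i<n. f (B $$ (i, i)))" using tri by simp
  also have "\<dots> = (\<Sum>e\<leftarrow>diag_mat B. f e)"
    using w(5) unfolding diag_mat_def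
    by (simp add: o_def sum_list_distinct_conv_sum_set interv_sum_list_conv_sum_set_nat lessThan_atLeast0)
  finally show ?thesis unfolding diag .
qed

section \<open>Multiplicity and location of eigenvalues\<close>

lemma order_prod_linear_factors:
  "Polynomial.order x (\<Prod>e\<leftarrow>es. [:- e, 1:]) = count_list es (x :: 'a :: idom)"
proof (induction es)
  case (Cons e es)
  have "[:- e, 1:] * (\<Prod>e\<leftarrow>es. [:- e, 1:]) \<noteq> 0"
    by (auto simp del: mult_pCons_left)
  then show ?case using Cons by (simp add: order_mult order_linear' del: mult_pCons_left)
qed simp

text \<open>Passes from the weighted sum over distinct eigenvalues, the form in which the energy is
  defined, to a sum over the list of roots with repetitions.\<close>

lemma sum_spectrum_order:
  fixes g :: "complex \<Rightarrow> real"
  assumes A: "A \<in> carrier_mat n n"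
    and es: "char_poly A = (\<Prod>e\<leftarrow>es. [:- e, 1:])"
  shows "(\<Sum>\<mu>\<in>spectrum A. real (Polynomial.order \<mu> (char_poly A)) * g \<mu>) = (\<Sum>e\<leftarrow>es. g e)"
proof -
  have "spectrum A = set es"
    unfolding spectrum_def eigenvalue_root_char_poly[OF A] es
    by (auto simp: poly_prod_list)
  moreover have "(\<Sum>e\<leftarrow>es. g e) = (\<Sum>\<mu>\<in>set es. real (count_list es \<mu>) * g \<mu>)"
  proof (induction es)
    case (Cons e es)
    show ?case
    proof (cases "e \<in> set es")
      case True
      have "(\<Sum>\<mu>\<in>set es - {e}. real (count_list (e # es) \<mu>) * g \<mu>) =
        (\<Sum>\<mu>\<in>set es - {e}. real (count_list es \<mu>) * g \<mu>)" by (intro sum.cong) auto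
      then show ?thesis using Cons True
        by (simp add: sum.remove[of "set es" e] insert_absorb algebra_simps)
    next
      case False
      then show ?thesis using Cons
        by (simp add: count_list_0_iff) (rule sum.cong; auto)
    qed
  qed simp
  ultimately show ?thesis unfolding es order_prod_linear_factors by simp
qed

lemma eigenvalueE:
  assumes A: "A \<in> carrier_mat n n" and "eigenvalue A e"
  obtains v :: "nat \<Rightarrow> 'a :: comm_ring_1" and i where "i < n" "v i \<noteq> 0"
    "\<And>i. i < n \<Longrightarrow> (\<Sum>j<n. A $$ (i, j) * v j) = e * v i"
proof -
  obtain v where v: "v \<in> carrier_vec n" "v \<noteq> 0\<^sub>v n" "A *\<^sub>v v = e \<cdot>\<^sub>v v"
    using assms unfolding eigenvalue_def eigenvector_def by auto
  from v(1,2) obtain i where "i < n" "v $ i \<noteq> 0" by (metis carrier_vecD eq_vecI index_zero_vec)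
  moreover have "(\<Sum>j<n. A $$ (i, j) * v $ j) = e * v $ i" if "i < n" for i
  proof -
    have "(A *\<^sub>v v) $ i = (\<Sum>j<n. A $$ (i, j) * v $ j)"
      using that A v(1) by (simp add: scalar_prod_def lessThan_atLeast0)
    thus ?thesis using v that by simp
  qed
  ultimately show ?thesis using that[of i "\<lambda>i. v $ i"] by blast
qed

text \<open>The value \<open>T\<close> of the Hermitian form at an eigenvector equals its own
  conjugate, and it is \<open>e\<close> times the positive number \<open>S\<close>.\<close>

lemma hermitian_eigenvalue_real:
  assumes A: "A \<in> carrier_mat n n"
    and herm: "\<And>i j. i < n \<Longrightarrow> j < n \<Longrightarrow> A $$ (j, i) = cnj (A $$ (i, j))"
    and "eigenvalue A e"
  shows "e \<in> \<real>"
proof -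
  obtain v i where i: "i < n" "v i \<noteq> 0"
    and ev: "\<And>i. i < n \<Longrightarrow> (\<Sum>j<n. A $$ (i, j) * v j) = e * v i"
    using eigenvalueE[OF A \<open>eigenvalue A e\<close>] by metis
  define S where "S = (\<Sum>i<n. (cmod (v i))\<^sup>2)"
  have S: "of_real S = (\<Sum>i<n. cnj (v i) * v i)"
    unfolding S_def by (simp add: complex_norm_square mult.commute del: of_real_power)
  have "S > 0" unfolding S_def using i by (intro sum_pos2[of _ i]) auto
  define T where "T = (\<Sum>i<n. \<Sum>j<n. cnj (v i) * (A $$ (i, j) * v j))"
  have "T = (\<Sum>i<n. cnj (v i) * (e * v i))"
    unfolding T_def by (simp add: sum_distrib_left[symmetric] ev)
  hence T: "T = e * of_real S" unfolding S by (simp add: sum_distrib_left algebra_simps)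
  have "cnj T = (\<Sum>i<n. \<Sum>j<n. cnj (v j) * (cnj (A $$ (i, j)) * v i))"
    unfolding T_def by (simp add: algebra_simps)
  also have "\<dots> = (\<Sum>i<n. \<Sum>j<n. cnj (v j) * (A $$ (j, i) * v i))"
    by (intro sum.cong refl) (simp add: herm[symmetric])
  also have "\<dots> = T" unfolding T_def by (rule sum.swap)
  finally have "cnj e * of_real S = e * of_real S" using T by simp
  thus ?thesis using \<open>S > 0\<close> by (simp add: Reals_cnj_iff)
qed

text \<open>At a coordinate where the eigenvector has largest modulus, the triangle inequality
  bounds the eigenvalue by the row sum.\<close>

lemma eigenvalue_norm_le_row_sum:
  fixes A :: "complex mat"
  assumes A: "A \<in> carrier_mat n n"
    and rows: "\<And>i. i < n \<Longrightarrow> (\<Sum>j<n. cmod (A $$ (i, j))) \<le> r"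
    and "eigenvalue A e"
  shows "cmod e \<le> r"
proof -
  obtain v i0 where i0: "i0 < n" "v i0 \<noteq> 0"
    and ev: "\<And>i. i < n \<Longrightarrow> (\<Sum>j<n. A $$ (i, j) * v j) = e * v i"
    using eigenvalueE[OF A \<open>eigenvalue A e\<close>] by metis
  define m where "m = Max ((\<lambda>i. cmod (v i)) ` {..<n})"
  have "m \<in> (\<lambda>i. cmod (v i)) ` {..<n}" unfolding m_def using i0 by (intro Max_in) auto
  then obtain i where i: "i < n" "m = cmod (v i)" by auto
  have le: "cmod (v j) \<le> m" if "j < n" for j unfolding m_def using that by (intro Max_ge) auto
  have "m > 0" using le[OF i0(1)] i0(2) by (smt (verit) zero_less_norm_iff)
  have "cmod e * m = cmod (\<Sum>j<n. A $$ (i, j) * v j)" using i ev by (simp add: norm_mult)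
  also have "\<dots> \<le> (\<Sum>j<n. cmod (A $$ (i, j)) * cmod (v j))"
    by (rule order.trans[OF norm_sum]) (simp add: norm_mult)
  also have "\<dots> \<le> (\<Sum>j<n. cmod (A $$ (i, j)) * m)"
    by (intro sum_mono mult_left_mono le) auto
  also have "\<dots> \<le> r * m"
    unfolding sum_distrib_right[symmetric] using rows[OF i(1)] \<open>m > 0\<close> by (intro mult_right_mono) auto
  finally show ?thesis using \<open>m > 0\<close> by simp
qed

lemma hermitian_real_spectrum:
  assumes A: "A \<in> carrier_mat n n"
    and herm: "\<And>i j. i < n \<Longrightarrow> j < n \<Longrightarrow> A $$ (j, i) = cnj (A $$ (i, j))"
  obtains xs :: "real list" where "char_poly A = (\<Prod>e\<leftarrow>map of_real xs. [:- e, 1:])"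
proof -
  obtain es where es: "char_poly A = (\<Prod>e\<leftarrow>es. [:- e, 1:])"
    using char_poly_factorized[OF A] by auto
  have "eigenvalue A e" if "e \<in> set es" for e
    unfolding eigenvalue_root_char_poly[OF A] es using that by (auto simp: poly_prod_list)
  hence "of_real (Re e) = e" if "e \<in> set es" for e
    using hermitian_eigenvalue_real[OF A herm] that by simp
  hence "map of_real (map Re es) = es" by (simp add: map_idI)
  thus ?thesis using es that[of "map Re es"] by simp
qed

section \<open>Spectra of regular graphs\<close>

text \<open>A bare vertex set and relation, so that a part of a graph can itself be treated as a
  regular graph.\<close>

locale regular_graph =
  fixes V :: "'a set" and E :: "('a \<times> 'a) set" and k :: nat
  assumes finite_V: "finite V"
    and E_subset: "E \<subseteq> V \<times> V"
    and sym_E: "sym E"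
    and irrefl_E: "irrefl E"
    and card_nbrs: "v \<in> V \<Longrightarrow> card (E `` {v}) = k"
begin

definition adj :: "'a \<Rightarrow> 'a \<Rightarrow> real" where
  "adj u v = of_bool ((u, v) \<in> E)"

text \<open>Matrix product of kernels indexed by the vertices themselves, so that combinatorial
  arguments involve no enumeration.\<close>

definition conv :: "('a \<Rightarrow> 'a \<Rightarrow> real) \<Rightarrow> ('a \<Rightarrow> 'a \<Rightarrow> real) \<Rightarrow> 'a \<Rightarrow> 'a \<Rightarrow> real" where
  "conv F G u v = (\<Sum>w\<in>V. F u w * G w v)"

definition codeg :: "'a \<Rightarrow> 'a \<Rightarrow> real" where
  "codeg u v = real (card (E `` {u} \<inter> E `` {v}))"

lemma E_commute: "(u, v) \<in> E \<longleftrightarrow> (v, u) \<in> E"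
  using sym_E by (auto dest: symD)

lemma E_irrefl: "(u, u) \<notin> E"
  using irrefl_E by (auto simp: irrefl_def)

lemma E_V: "(u, v) \<in> E \<Longrightarrow> u \<in> V" "(u, v) \<in> E \<Longrightarrow> v \<in> V"
  using E_subset by auto

lemma finite_nbrs: "finite (E `` {u})"
  by (rule finite_subset[OF _ finite_V]) (auto dest: E_V)

lemma codeg_commute: "codeg u v = codeg v u"
  unfolding codeg_def by (simp add: Int_commute)

lemma codeg_self: "u \<in> V \<Longrightarrow> codeg u u = real k"
  unfolding codeg_def by (simp add: card_nbrs)

lemma sum_adj: assumes "u \<in> V" shows "(\<Sum>v\<in>V. adj u v) = real k"
proof -
  have "V \<inter> {v. (u, v) \<in> E} = E `` {u}" by (auto dest: E_V)
  thus ?thesis unfolding adj_def using finite_V assms by (simp add: sum.If_cases of_bool_def card_nbrs)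
qed

lemma conv_adj: "conv adj adj = codeg"
proof (intro ext)
  fix u v
  have "adj u w * adj w v = of_bool (w \<in> E `` {u} \<inter> E `` {v})" for w
    unfolding adj_def using E_commute[of w v] by simp
  hence "conv adj adj u v = (\<Sum>w\<in>V. of_bool (w \<in> E `` {u} \<inter> E `` {v}))"
    unfolding conv_def by simp
  also have "\<dots> = real (card (V \<inter> {w. w \<in> E `` {u} \<inter> E `` {v}}))"
    using finite_V by (simp add: sum.If_cases of_bool_def)
  also have "V \<inter> {w. w \<in> E `` {u} \<inter> E `` {v}} = E `` {u} \<inter> E `` {v}"
    using E_V by blast
  also have "real (card \<dots>) = codeg u v" by (simp add: codeg_def)
  finally show "conv adj adj u v = codeg u v" .
qed

text \<open>Row sum of the squared adjacency matrix: it counts the walks of length two from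
  \<open>u\<close>.\<close>

lemma sum_codeg: assumes "u \<in> V" shows "(\<Sum>v\<in>V. codeg u v) = (real k)\<^sup>2"
proof -
  have "(\<Sum>v\<in>V. codeg u v) = (\<Sum>v\<in>V. \<Sum>w\<in>V. adj u w * adj w v)"
    by (simp add: conv_def flip: conv_adj)
  also have "\<dots> = (\<Sum>w\<in>V. adj u w * (\<Sum>v\<in>V. adj w v))"
    by (subst sum.swap) (simp add: sum_distrib_left)
  also have "\<dots> = (\<Sum>w\<in>V. adj u w * real k)" by (simp add: sum_adj)
  also have "\<dots> = (real k)\<^sup>2" using assms by (simp add: sum_distrib_right[symmetric] sum_adj power2_eq_square)
  finally show ?thesis .
qed

end

section \<open>Polynomials in the adjacency matrix as kernels on the vertices\<close>

locale enumerated_regular_graph = regular_graph +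
  fixes vs :: "'a list"
  assumes distinct_vs: "distinct vs" and set_vs: "set vs = V"
begin

abbreviation "n \<equiv> length vs"

definition kernel_mat :: "('a \<Rightarrow> 'a \<Rightarrow> real) \<Rightarrow> complex mat" where
  "kernel_mat F = mat n n (\<lambda>(i, j). of_real (F (vs ! i) (vs ! j)))"

text \<open>Real counterpart of \<open>mat_poly\<close>: the kernel \<open>F\<close> is a polynomial
  in \<open>adj\<close>. The matrices are complex for the sake of the Schur decomposition, but the
  eigenvalues are real, so only values at real points are recorded.\<close>

definition adj_poly :: "('a \<Rightarrow> 'a \<Rightarrow> real) \<Rightarrow> (real \<Rightarrow> real) \<Rightarrow> bool" where
  "adj_poly F f \<longleftrightarrow>
     (\<exists>g. mat_poly (kernel_mat adj) (kernel_mat F) g \<and> (\<forall>x. g (of_real x) = of_real (f x)))"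

lemma sum_nth_vs: "(\<Sum>i<n. g (vs ! i)) = (\<Sum>v\<in>V. g v)"
  using sum.reindex_bij_betw[OF bij_betw_nth[OF distinct_vs refl set_vs[symmetric]]] .

lemma nth_vs_in: "i < n \<Longrightarrow> vs ! i \<in> V"
  using set_vs nth_mem by auto

lemma kernel_mat_carrier: "kernel_mat F \<in> carrier_mat n n"
  unfolding kernel_mat_def by simp

lemma adj_poly_cong:
  assumes "adj_poly F f" "\<And>u v. u \<in> V \<Longrightarrow> v \<in> V \<Longrightarrow> F u v = G u v"
  shows "adj_poly G f"
proof -
  have "kernel_mat F = kernel_mat G"
    unfolding kernel_mat_def using assms(2) nth_vs_in by (intro eq_matI) auto
  thus ?thesis using assms(1) unfolding adj_poly_def by simp
qed

lemma adj_poly_one: "adj_poly (\<lambda>u v. of_bool (u = v)) (\<lambda>_. 1)"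
proof -
  have "kernel_mat (\<lambda>u v. of_bool (u = v)) = 1\<^sub>m n"
    unfolding kernel_mat_def using distinct_vs by (intro eq_matI) (auto simp: nth_eq_iff_index_eq)
  moreover have "mat_poly (kernel_mat adj) (1\<^sub>m n) (\<lambda>_. 1)"
    using mat_poly.one[of "kernel_mat adj"] by (simp add: kernel_mat_def)
  ultimately show ?thesis unfolding adj_poly_def by force
qed

lemma adj_poly_adj: "adj_poly adj (\<lambda>x. x)"
  unfolding adj_poly_def using mat_poly.self by force

lemma adj_poly_add:
  assumes "adj_poly F f" "adj_poly G g"
  shows "adj_poly (\<lambda>u v. F u v + G u v) (\<lambda>x. f x + g x)"
proof -
  have "kernel_mat (\<lambda>u v. F u v + G u v) = kernel_mat F + kernel_mat G"
    unfolding kernel_mat_def by (intro eq_matI) auto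
  moreover obtain f' g' where
    "mat_poly (kernel_mat adj) (kernel_mat F) f'" "\<And>x. f' (of_real x) = of_real (f x)"
    "mat_poly (kernel_mat adj) (kernel_mat G) g'" "\<And>x. g' (of_real x) = of_real (g x)"
    using assms unfolding adj_poly_def by blast
  ultimately show ?thesis
    unfolding adj_poly_def by (intro exI[of _ "\<lambda>x. f' x + g' x"]) (simp add: mat_poly.add)
qed

lemma adj_poly_scale:
  assumes "adj_poly F f"
  shows "adj_poly (\<lambda>u v. c * F u v) (\<lambda>x. c * f x)"
proof -
  have "kernel_mat (\<lambda>u v. c * F u v) = of_real c \<cdot>\<^sub>m kernel_mat F"
    unfolding kernel_mat_def by (intro eq_matI) auto
  moreover obtain f' where
    "mat_poly (kernel_mat adj) (kernel_mat F) f'" "\<And>x. f' (of_real x) = of_real (f x)"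
    using assms unfolding adj_poly_def by blast
  ultimately show ?thesis
    unfolding adj_poly_def by (intro exI[of _ "\<lambda>x. of_real c * f' x"]) (simp add: mat_poly.smult)
qed

lemma adj_poly_conv:
  assumes "adj_poly F f" "adj_poly G g"
  shows "adj_poly (conv F G) (\<lambda>x. f x * g x)"
proof -
  have "kernel_mat (conv F G) = kernel_mat F * kernel_mat G"
  proof (rule eq_matI)
    fix i j assume ij: "i < dim_row (kernel_mat F * kernel_mat G)" "j < dim_col (kernel_mat F * kernel_mat G)"
    have "(kernel_mat F * kernel_mat G) $$ (i, j) =
      (\<Sum>l<n. of_real (F (vs ! i) (vs ! l) * G (vs ! l) (vs ! j)))"
      using ij by (simp add: kernel_mat_def scalar_prod_def lessThan_atLeast0)
    also have "\<dots> = of_real (conv F G (vs ! i) (vs ! j))"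
      unfolding conv_def of_real_sum
      using sum_nth_vs[of "\<lambda>w. complex_of_real (F (vs ! i) w * G w (vs ! j))"] .
    finally show "kernel_mat (conv F G) $$ (i, j) = (kernel_mat F * kernel_mat G) $$ (i, j)"
      using ij by (simp add: kernel_mat_def)
  qed (auto simp: kernel_mat_def)
  moreover obtain f' g' where
    "mat_poly (kernel_mat adj) (kernel_mat F) f'" "\<And>x. f' (of_real x) = of_real (f x)"
    "mat_poly (kernel_mat adj) (kernel_mat G) g'" "\<And>x. g' (of_real x) = of_real (g x)"
    using assms unfolding adj_poly_def by blast
  ultimately show ?thesis
    unfolding adj_poly_def by (intro exI[of _ "\<lambda>x. f' x * g' x"]) (simp add: mat_poly.mult)
qed

definition is_spectrum :: "real list \<Rightarrow> bool" where
  "is_spectrum xs \<longleftrightarrow> char_poly (kernel_mat adj) = (\<Prod>e\<leftarrow>map of_real xs. [:- e, 1:])"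

lemma is_spectrum_exists: "\<exists>xs. is_spectrum xs"
proof -
  have "kernel_mat adj $$ (j, i) = cnj (kernel_mat adj $$ (i, j))" if "i < n" "j < n" for i j
    using that by (simp add: kernel_mat_def adj_def E_commute)
  thus ?thesis
    using hermitian_real_spectrum[OF kernel_mat_carrier] unfolding is_spectrum_def by metis
qed

text \<open>The link between eigenvalues and combinatorics: for powers of \<open>adj\<close> the
  right side counts closed walks.\<close>

lemma spectrum_trace:
  assumes "is_spectrum xs" "adj_poly F f"
  shows "(\<Sum>x\<leftarrow>xs. f x) = (\<Sum>v\<in>V. F v v)"
proof -
  obtain g where g: "mat_poly (kernel_mat adj) (kernel_mat F) g" "\<And>x. g (of_real x) = of_real (f x)"
    using assms(2) unfolding adj_poly_def by blast
  have "(\<Sum>i<n. kernel_mat F $$ (i, i)) = (\<Sum>e\<leftarrow>map of_real xs. g e)"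
    by (rule trace_mat_poly[OF kernel_mat_carrier assms(1)[unfolded is_spectrum_def] g(1)])
  also have "\<dots> = of_real (\<Sum>x\<leftarrow>xs. f x)"
    by (induction xs) (auto simp: g(2))
  also have "(\<Sum>i<n. kernel_mat F $$ (i, i)) = of_real (\<Sum>v\<in>V. F v v)"
    using sum_nth_vs[of "\<lambda>v. F v v"] by (simp add: kernel_mat_def flip: of_real_sum)
  finally show ?thesis by (metis of_real_eq_iff)
qed

lemma length_spectrum:
  assumes "is_spectrum xs"
  shows "length xs = card V"
proof -
  have "(\<Sum>x\<leftarrow>xs. 1 :: real) = (\<Sum>v\<in>V. of_bool (v = v))"
    by (rule spectrum_trace[OF assms adj_poly_one])
  thus ?thesis by (simp add: sum_list_triv)
qed

text \<open>Every row of the adjacency matrix has sum \<open>k\<close>.\<close>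

lemma spectrum_bounded:
  assumes "is_spectrum xs" "x \<in> set xs"
  shows "\<bar>x\<bar> \<le> real k"
proof -
  have "(\<Sum>j<n. cmod (kernel_mat adj $$ (i, j))) \<le> real k" if "i < n" for i
  proof -
    have "(\<Sum>j<n. cmod (kernel_mat adj $$ (i, j))) = (\<Sum>j<n. adj (vs ! i) (vs ! j))"
      using that by (intro sum.cong) (auto simp: kernel_mat_def adj_def)
    thus ?thesis using sum_nth_vs[of "adj (vs ! i)"] sum_adj[OF nth_vs_in[OF that]] by simp
  qed
  moreover have "eigenvalue (kernel_mat adj) (of_real x)"
    unfolding eigenvalue_root_char_poly[OF kernel_mat_carrier] assms(1)[unfolded is_spectrum_def]
    using assms(2) by (auto simp: poly_prod_list)
  ultimately show ?thesis using eigenvalue_norm_le_row_sum[OF kernel_mat_carrier] by fastforce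
qed

end

section \<open>The energy bound and its equality case\<close>

text \<open>The left side is the contribution per vertex of all terms of the quartic other than the
  energy, in the absence of 4-cycles. The right side is the coefficient of the energy times the
  claimed bound. After the denominator is cleared, both are polynomials in \<open>s\<close>.\<close>

lemma gap_identity:
  fixes s K :: real
  assumes K: "K = s\<^sup>2 + 1"
  shows "K * (3 * s\<^sup>2 + K * (K + 2 * s) + s\<^sup>2 * (K + 2 * s) - (2 * K - 1)) =
    2 * s * (K + s)\<^sup>2 * ((K + (K\<^sup>2 - K) * s) / (K\<^sup>2 - K + 1))"
proof -
  have "K\<^sup>2 - K + 1 = s^4 + s\<^sup>2 + 1" unfolding K by (simp add: power2_eq_square power4_eq_xxxx algebra_simps)
  moreover have "s^4 + s\<^sup>2 + 1 > 0" by (smt (verit) zero_le_even_power even_numeral)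
  ultimately have "K\<^sup>2 - K + 1 \<noteq> 0" by simp
  moreover have "K * (3 * s\<^sup>2 + K * (K + 2 * s) + s\<^sup>2 * (K + 2 * s) - (2 * K - 1)) * (K\<^sup>2 - K + 1) =
    2 * s * (K + s)\<^sup>2 * (K + (K\<^sup>2 - K) * s)"
    unfolding K by (simp add: algebra_simps power2_eq_square)
  ultimately show ?thesis by (simp add: nonzero_eq_divide_eq)
qed

section \<open>Common neighbours and 4-cycles\<close>

context regular_graph
begin

definition near :: "'a \<Rightarrow> 'a \<Rightarrow> bool" where
  "near u v \<longleftrightarrow> u \<in> V \<and> v \<in> V \<and> (u = v \<or> E `` {u} \<inter> E `` {v} \<noteq> {})"

definition four_cycle_free :: bool where
  "four_cycle_free \<longleftrightarrow> (\<forall>u\<in>V. \<forall>v\<in>V. u \<noteq> v \<longrightarrow> card (E `` {u} \<inter> E `` {v}) \<le> 1)"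

definition near_transitive :: bool where
  "near_transitive \<longleftrightarrow> (\<forall>u v w. near u v \<longrightarrow> near v w \<longrightarrow> near u w)"

lemma near_V: "near u v \<Longrightarrow> u \<in> V" "near u v \<Longrightarrow> v \<in> V"
  by (auto simp: near_def)

lemma near_sym: "near u v \<Longrightarrow> near v u"
  by (auto simp: near_def)

lemma near_refl: "u \<in> V \<Longrightarrow> near u u"
  by (auto simp: near_def)

text \<open>Off the diagonal the codegree is 0 or 1. In matrix form, A^2 = N + (k - 1) I with N the
  matrix of \<open>near\<close>.\<close>

lemma codeg_near:
  assumes four_cycle_free "u \<in> V" "v \<in> V"
  shows "codeg u v = of_bool (near u v) + (real k - 1) * of_bool (u = v)"
proof (cases "u = v")
  case True
  then show ?thesis using assms by (simp add: codeg_self near_refl)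
next
  case False
  hence "card (E `` {u} \<inter> E `` {v}) \<le> 1" using assms unfolding four_cycle_free_def by blast
  moreover have "card (E `` {u} \<inter> E `` {v}) = 0 \<longleftrightarrow> \<not> near u v"
    using False assms finite_nbrs[of u] by (simp add: near_def)
  ultimately show ?thesis using False unfolding codeg_def
    by (cases "card (E `` {u} \<inter> E `` {v})") auto
qed

text \<open>Row sum of A^2 - (k - 1) I, which is k^2 - (k - 1).\<close>

lemma card_near:
  assumes four_cycle_free "u \<in> V"
  shows "real (card {v. near u v}) = (real k)\<^sup>2 - real k + 1"
proof -
  have "V \<inter> {v. near u v} = {v. near u v}" by (auto dest: near_V)
  hence "real (card {v. near u v}) = (\<Sum>v\<in>V. of_bool (near u v))"
    using finite_V by (simp add: sum.If_cases of_bool_def)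
  also have "\<dots> = (\<Sum>v\<in>V. codeg u v - (real k - 1) * of_bool (v = u))"
    using assms by (intro sum.cong) (auto simp: codeg_near)
  also have "\<dots> = (real k)\<^sup>2 - (real k - 1)"
    using finite_V assms
    by (simp add: sum_subtractf sum_codeg of_bool_def flip: sum_distrib_left)
  finally show ?thesis by simp
qed

text \<open>Eight times the number of 4-cycles: each is counted through either diagonal, with both
  orders of its ends and both orders of the other two vertices.\<close>

definition excess :: real where
  "excess = (\<Sum>u\<in>V. \<Sum>v\<in>V - {u}. codeg u v * (codeg u v - 1))"

text \<open>This uses integrality: the product is negative only strictly between 0 and 1.\<close>

lemma real_mult_pred_nonneg: "real c * (real c - 1) \<ge> 0"
  by (cases c) auto

lemma real_mult_pred_eq_0_iff: "real c * (real c - 1) = 0 \<longleftrightarrow> c \<le> 1"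
  by (cases c) auto

lemma codeg_mult_pred_nonneg: "codeg u v * (codeg u v - 1) \<ge> 0"
  and codeg_mult_pred_eq_0_iff: "codeg u v * (codeg u v - 1) = 0 \<longleftrightarrow> card (E `` {u} \<inter> E `` {v}) \<le> 1"
  unfolding codeg_def by (rule real_mult_pred_nonneg real_mult_pred_eq_0_iff)+

lemma excess_nonneg: "excess \<ge> 0"
  unfolding excess_def by (intro sum_nonneg codeg_mult_pred_nonneg)

lemma excess_eq_0_iff: "excess = 0 \<longleftrightarrow> four_cycle_free"
proof -
  have "excess = 0 \<longleftrightarrow> (\<forall>u\<in>V. \<forall>v\<in>V - {u}. codeg u v * (codeg u v - 1) = 0)"
    unfolding excess_def using finite_V
    by (simp add: sum_nonneg_eq_0_iff sum_nonneg codeg_mult_pred_nonneg del: mult_eq_0_iff)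
  thus ?thesis unfolding codeg_mult_pred_eq_0_iff four_cycle_free_def by auto
qed

text \<open>Write c^2 = c (c - 1) + c. In each row the linear part sums to k^2 and the diagonal adds
  k (k - 1); what remains is \<open>excess\<close>.\<close>

lemma sum_codeg_sq:
  "(\<Sum>u\<in>V. \<Sum>v\<in>V. (codeg u v)\<^sup>2) = excess + real (card V) * (real k * (2 * real k - 1))"
proof -
  have "(\<Sum>v\<in>V. (codeg u v)\<^sup>2) =
    (\<Sum>v\<in>V - {u}. codeg u v * (codeg u v - 1)) + real k * (2 * real k - 1)" if "u \<in> V" for u
  proof -
    have "(\<Sum>v\<in>V. (codeg u v)\<^sup>2) = (\<Sum>v\<in>V. codeg u v * (codeg u v - 1)) + (\<Sum>v\<in>V. codeg u v)"
      unfolding sum.distrib[symmetric] by (simp add: algebra_simps power2_eq_square)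
    also have "(\<Sum>v\<in>V. codeg u v * (codeg u v - 1)) =
      real k * (real k - 1) + (\<Sum>v\<in>V - {u}. codeg u v * (codeg u v - 1))"
      using that finite_V by (simp add: sum.remove codeg_self)
    finally show ?thesis using that by (simp add: sum_codeg power2_eq_square algebra_simps)
  qed
  hence "(\<Sum>u\<in>V. \<Sum>v\<in>V. (codeg u v)\<^sup>2) =
    (\<Sum>u\<in>V. (\<Sum>v\<in>V - {u}. codeg u v * (codeg u v - 1)) + real k * (2 * real k - 1))" by simp
  thus ?thesis unfolding excess_def by (simp add: sum.distrib)
qed

text \<open>The entry of N^2 at \<open>(u, v)\<close> counts the vertices near both. All near sets
  have size \<open>?m\<close>, so the equation says that the sets of \<open>u\<close> and
  \<open>v\<close> coincide or are disjoint, according to whether \<open>u\<close> and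
  \<open>v\<close> are near.\<close>

lemma near_transitive_iff:
  assumes four_cycle_free
  shows "near_transitive \<longleftrightarrow> (\<forall>u\<in>V. \<forall>v\<in>V.
    conv (\<lambda>u v. of_bool (near u v)) (\<lambda>u v. of_bool (near u v)) u v =
    ((real k)\<^sup>2 - real k + 1) * of_bool (near u v))"
    (is "_ \<longleftrightarrow> (\<forall>u\<in>V. \<forall>v\<in>V. conv ?R ?R u v = ?m * ?R u v)")
proof -
  have fin: "finite {w. near u w}" for u
    by (rule finite_subset[OF _ finite_V]) (auto dest: near_V)
  have conv: "conv ?R ?R u v = real (card ({w. near u w} \<inter> {w. near v w}))" for u v
  proof -
    have "conv ?R ?R u v = (\<Sum>w\<in>V. of_bool (w \<in> {w. near u w} \<inter> {w. near v w}))"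
      unfolding conv_def by (intro sum.cong) (auto dest: near_sym)
    also have "\<dots> = real (card (V \<inter> {w. w \<in> {w. near u w} \<inter> {w. near v w}}))"
      using finite_V by (simp add: sum.If_cases of_bool_def)
    also have "V \<inter> {w. w \<in> {w. near u w} \<inter> {w. near v w}} = {w. near u w} \<inter> {w. near v w}"
      by (auto dest: near_V)
    finally show ?thesis .
  qed
  show ?thesis
  proof
    assume trans: near_transitive
    show "\<forall>u\<in>V. \<forall>v\<in>V. conv ?R ?R u v = ?m * ?R u v"
    proof (intro ballI)
      fix u v assume uv: "u \<in> V" "v \<in> V"
      show "conv ?R ?R u v = ?m * ?R u v"
      proof (cases "near u v")
        case True
        hence "{w. near u w} \<inter> {w. near v w} = {w. near u w}"
          using trans near_sym unfolding near_transitive_def by blast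
        then show ?thesis using True uv assms by (simp add: conv card_near)
      next
        case False
        hence "{w. near u w} \<inter> {w. near v w} = {}"
          using trans near_sym unfolding near_transitive_def by blast
        then show ?thesis using False by (simp add: conv)
      qed
    qed
  next
    assume R: "\<forall>u\<in>V. \<forall>v\<in>V. conv ?R ?R u v = ?m * ?R u v"
    show near_transitive unfolding near_transitive_def
    proof (intro allI impI)
      fix u v w assume uv: "near u v" and vw: "near v w"
      hence V: "u \<in> V" "v \<in> V" by (auto dest: near_V)
      hence "real (card ({w. near u w} \<inter> {w. near v w})) = ?m" using R uv by (simp add: conv[symmetric])
      \<comment> \<open>The intersection is as large as the whole near set of \<open>v\<close>,
        hence equal to it.\<close>
      hence "card ({w. near u w} \<inter> {w. near v w}) = card {w. near v w}"
        using card_near[OF assms V(2)] by linarith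
      hence "{w. near u w} \<inter> {w. near v w} = {w. near v w}" by (intro card_subset_eq fin) auto
      thus "near u w" using vw by blast
    qed
  qed
qed

end

section \<open>Transitivity read off the spectrum, and the energy gap\<close>

context enumerated_regular_graph
begin

lemma adj_poly_near:
  assumes four_cycle_free
  shows "adj_poly (\<lambda>u v. of_bool (near u v)) (\<lambda>x. x\<^sup>2 - (real k - 1))"
proof (rule adj_poly_cong)
  show "adj_poly (\<lambda>u v. conv adj adj u v + (- (real k - 1)) * of_bool (u = v)) (\<lambda>x. x\<^sup>2 - (real k - 1))"
    using adj_poly_add[OF adj_poly_conv[OF adj_poly_adj adj_poly_adj]
        adj_poly_scale[OF adj_poly_one, of "- (real k - 1)"]]
    unfolding power2_eq_square mult_1_right by (simp only: diff_conv_add_uminus)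
qed (simp add: conv_adj codeg_near[OF assms] del: minus_diff_eq)

text \<open>The kernel below vanishes exactly when \<^term>\<open>near\<close> is an equivalence relation; being symmetric, it
  vanishes exactly when the trace of its square does.\<close>

lemma spectrum_near_transitive_iff:
  assumes four_cycle_free and xs: "is_spectrum xs"
  shows "near_transitive \<longleftrightarrow> (\<forall>x\<in>set xs. (x\<^sup>2 - (real k - 1)) * (x\<^sup>2 - (real k)\<^sup>2) = 0)"
proof -
  let ?R = "\<lambda>u v. of_bool (near u v) :: real"
  let ?m = "(real k)\<^sup>2 - real k + 1"
  let ?h = "\<lambda>x. (x\<^sup>2 - (real k - 1)) * (x\<^sup>2 - (real k)\<^sup>2)"
  define M where "M = (\<lambda>u v. conv ?R ?R u v + (- ?m) * ?R u v)"
  have "adj_poly M (\<lambda>x. (x\<^sup>2 - (real k - 1)) * (x\<^sup>2 - (real k - 1)) + (- ?m) * (x\<^sup>2 - (real k - 1)))"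
    unfolding M_def
    by (intro adj_poly_add adj_poly_scale adj_poly_conv adj_poly_near assms)
  \<comment> \<open>Since \<open>?m\<close> is k^2 - (k - 1), the factor x^2 - (k - 1) -
    \<open>?m\<close> is x^2 - k^2.\<close>
  moreover have "(x\<^sup>2 - (real k - 1)) * (x\<^sup>2 - (real k - 1)) + (- ?m) * (x\<^sup>2 - (real k - 1)) = ?h x" for x
    by (simp add: algebra_simps)
  ultimately have "adj_poly M ?h" by simp
  hence tr: "(\<Sum>x\<leftarrow>xs. ?h x * ?h x) = (\<Sum>v\<in>V. conv M M v v)"
    by (intro spectrum_trace[OF xs] adj_poly_conv)
  have near_commute: "near u v \<longleftrightarrow> near v u" for u v using near_sym by blast
  have R_sym: "conv ?R ?R u v = conv ?R ?R v u" for u v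
    unfolding conv_def by (intro sum.cong refl) (simp add: near_commute[of _ v] near_commute[of u])
  have M_sym: "M u v = M v u" for u v
    unfolding M_def using near_commute[of u v] R_sym[of u v] by (simp only:)
  have "conv M M v v = (\<Sum>w\<in>V. (M v w)\<^sup>2)" for v
    unfolding conv_def power2_eq_square by (intro sum.cong refl arg_cong2[where f = "(*)"] M_sym)
  hence "(\<Sum>v\<in>V. conv M M v v) = (\<Sum>v\<in>V. \<Sum>w\<in>V. (M v w)\<^sup>2)" by simp
  with tr have sums: "(\<Sum>x\<leftarrow>xs. (?h x)\<^sup>2) = (\<Sum>v\<in>V. \<Sum>w\<in>V. (M v w)\<^sup>2)"
    by (simp add: power2_eq_square)
  have "near_transitive \<longleftrightarrow> (\<forall>u\<in>V. \<forall>v\<in>V. M u v = 0)"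
    unfolding near_transitive_iff[OF assms(1)] M_def by (simp add: algebra_simps)
  also have "\<dots> \<longleftrightarrow> (\<Sum>v\<in>V. \<Sum>w\<in>V. (M v w)\<^sup>2) = 0"
    using finite_V by (simp add: sum_nonneg_eq_0_iff sum_nonneg)
  also have "\<dots> \<longleftrightarrow> (\<forall>x\<in>set xs. ?h x = 0)"
    unfolding sums[symmetric] by (subst sum_list_nonneg_eq_0_iff) auto
  finally show ?thesis .
qed

text \<open>The double root \<open>s\<close> and the root \<open>k\<close> are the values of \<open>\<bar>x\<bar>\<close> in the extremal case; the absence
  of a cubic term then forces the fourth root \<open>- (k + 2 * s)\<close>.\<close>

lemma energy_gap:
  fixes s :: real and xs :: "real list"
  assumes k: "k \<ge> 2" and s: "s = sqrt (real k - 1)"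
    and xs: "is_spectrum xs"
  shows "(\<Sum>x\<leftarrow>xs. (\<bar>x\<bar> - s)\<^sup>2 * (real k - \<bar>x\<bar>) * (\<bar>x\<bar> + 2 * s + real k)) + excess =
    2 * s * (real k + s)\<^sup>2 * (real (card V) *
      ((real k + ((real k)\<^sup>2 - real k) * s) / ((real k)\<^sup>2 - real k + 1)) - (\<Sum>x\<leftarrow>xs. \<bar>x\<bar>))"
proof -
  let ?K = "real k"
  have K: "?K = s\<^sup>2 + 1" using k s by simp
  have "(\<Sum>x\<leftarrow>xs. x * x) = (\<Sum>v\<in>V. conv adj adj v v)"
    by (intro spectrum_trace[OF xs] adj_poly_conv adj_poly_adj)
  hence t2: "(\<Sum>x\<leftarrow>xs. x\<^sup>2) = real (card V) * ?K"
    by (simp add: conv_adj codeg_self power2_eq_square)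
  \<comment> \<open>By symmetry, the trace of A^4 is the sum of the squared entries of A^2.\<close>
  have "(\<Sum>x\<leftarrow>xs. (x * x) * (x * x)) = (\<Sum>v\<in>V. conv (conv adj adj) (conv adj adj) v v)"
    by (intro spectrum_trace[OF xs] adj_poly_conv adj_poly_adj)
  also have "\<dots> = (\<Sum>u\<in>V. \<Sum>v\<in>V. (codeg u v)\<^sup>2)"
    unfolding conv_adj unfolding conv_def
    by (intro sum.cong refl) (simp add: power2_eq_square codeg_commute)
  finally have t4: "(\<Sum>x\<leftarrow>xs. x^4) = excess + real (card V) * (?K * (2 * ?K - 1))"
    unfolding sum_codeg_sq by (simp add: power4_eq_xxxx mult.assoc)
  have g: "(\<bar>x\<bar> - s)\<^sup>2 * (?K - \<bar>x\<bar>) * (\<bar>x\<bar> + 2 * s + ?K) =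
    - (x^4) + (3 * s\<^sup>2 + ?K * (?K + 2 * s)) * x\<^sup>2 - 2 * s * (?K + s)\<^sup>2 * \<bar>x\<bar> + s\<^sup>2 * ?K * (?K + 2 * s)"
    for x
  proof -
    \<comment> \<open>Even powers do not see the absolute value. The only odd term of the expansion
      is the linear one, which sums to the energy.\<close>
    have "x^4 = \<bar>x\<bar>^4" "x\<^sup>2 = \<bar>x\<bar>\<^sup>2" by simp_all
    thus ?thesis by (simp only:) (simp add: power2_eq_square power4_eq_xxxx algebra_simps)
  qed
  have "(\<Sum>x\<leftarrow>xs. (\<bar>x\<bar> - s)\<^sup>2 * (?K - \<bar>x\<bar>) * (\<bar>x\<bar> + 2 * s + ?K)) =
    - (\<Sum>x\<leftarrow>xs. x^4) + (3 * s\<^sup>2 + ?K * (?K + 2 * s)) * (\<Sum>x\<leftarrow>xs. x\<^sup>2)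
    - 2 * s * (?K + s)\<^sup>2 * (\<Sum>x\<leftarrow>xs. \<bar>x\<bar>) + real (length xs) * (s\<^sup>2 * ?K * (?K + 2 * s))"
    unfolding g by (induction xs) (simp_all add: algebra_simps)
  also have "\<dots> = real (card V) *
    (?K * (3 * s\<^sup>2 + ?K * (?K + 2 * s) + s\<^sup>2 * (?K + 2 * s) - (2 * ?K - 1))) - excess
    - 2 * s * (?K + s)\<^sup>2 * (\<Sum>x\<leftarrow>xs. \<bar>x\<bar>)"
    unfolding t2 t4 length_spectrum[OF xs] by (simp add: algebra_simps)
  finally show ?thesis unfolding gap_identity[OF K] by (simp add: algebra_simps)
qed

text \<open>By \<open>energy_gap\<close> a positive multiple of \<open>B - eps\<close> is a sum of
  nonnegative terms, so equality means that all of them vanish. For \<open>excess\<close> this is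
  \<open>four_cycle_free\<close>; given that, for the eigenvalues it is
  \<open>near_transitive\<close>.\<close>

lemma energy_bound:
  assumes k: "k \<ge> 2" and V: "V \<noteq> {}"
    and eps: "eps = (\<Sum>\<mu>\<in>spectrum (kernel_mat adj).
              real (Polynomial.order \<mu> (char_poly (kernel_mat adj))) * cmod \<mu>) / real (card V)"
    and B: "B = (real k + ((real k)\<^sup>2 - real k) * sqrt (real k - 1)) / ((real k)\<^sup>2 - real k + 1)"
  shows "eps \<le> B" and "eps = B \<longleftrightarrow> four_cycle_free \<and> near_transitive"
proof -
  obtain xs where xs: "is_spectrum xs" using is_spectrum_exists ..
  define s where "s = sqrt (real k - 1)"
  have s: "s > 0" "s\<^sup>2 = real k - 1" "s \<ge> 0" using k by (auto simp: s_def)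
  let ?g = "\<lambda>x. (\<bar>x\<bar> - s)\<^sup>2 * (real k - \<bar>x\<bar>) * (\<bar>x\<bar> + 2 * s + real k)"
  have cV: "real (card V) > 0" using V finite_V by (simp add: card_gt_0_iff)
  have "eps = (\<Sum>e\<leftarrow>map of_real xs. cmod e) / real (card V)"
    unfolding eps sum_spectrum_order[OF kernel_mat_carrier xs[unfolded is_spectrum_def]] ..
  hence en: "real (card V) * eps = (\<Sum>x\<leftarrow>xs. \<bar>x\<bar>)" using cV by (simp add: o_def)
  have "(\<Sum>x\<leftarrow>xs. ?g x) + excess = 2 * s * (real k + s)\<^sup>2 * (real (card V) * B - (\<Sum>x\<leftarrow>xs. \<bar>x\<bar>))"
    unfolding B using energy_gap[OF k s_def xs] by (simp add: s_def)
  also have "\<dots> = (2 * s * (real k + s)\<^sup>2 * real (card V)) * (B - eps)"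
    unfolding en[symmetric] by (simp add: algebra_simps)
  finally have gap: "(\<Sum>x\<leftarrow>xs. ?g x) + excess = (2 * s * (real k + s)\<^sup>2 * real (card V)) * (B - eps)" .
  have pos: "2 * s * (real k + s)\<^sup>2 * real (card V) > 0" using s k cV by simp
  have g: "?g x \<ge> 0" if "x \<in> set xs" for x
    using spectrum_bounded[OF xs that] s by (intro mult_nonneg_nonneg) auto
  have gs: "(\<Sum>x\<leftarrow>xs. ?g x) \<ge> 0" using g by (intro sum_list_nonneg) auto
  have "0 \<le> (2 * s * (real k + s)\<^sup>2 * real (card V)) * (B - eps)"
    using gap gs excess_nonneg by linarith
  thus "eps \<le> B" using pos by (simp add: zero_le_mult_iff)
  have "eps = B \<longleftrightarrow> (2 * s * (real k + s)\<^sup>2 * real (card V)) * (B - eps) = 0"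
    using pos by (simp add: less_imp_neq[symmetric]) (use s cV k in auto)
  also have "\<dots> \<longleftrightarrow> (\<Sum>x\<leftarrow>xs. ?g x) = 0 \<and> excess = 0"
    unfolding gap[symmetric] using gs excess_nonneg by linarith
  also have "(\<Sum>x\<leftarrow>xs. ?g x) = 0 \<longleftrightarrow> (\<forall>x\<in>set xs. ?g x = 0)"
    using g by (subst sum_list_nonneg_eq_0_iff) auto
  also have "\<dots> \<longleftrightarrow> (\<forall>x\<in>set xs. (x\<^sup>2 - (real k - 1)) * (x\<^sup>2 - (real k)\<^sup>2) = 0)"
  proof (intro ball_cong refl)
    fix x
    \<comment> \<open>The last factor is positive, so the zeros come from the other two.\<close>
    have "\<bar>x\<bar> + 2 * s + real k > 0" using s k by simp
    hence "?g x = 0 \<longleftrightarrow> \<bar>x\<bar> = s \<or> \<bar>x\<bar> = real k" by auto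
    moreover have "\<bar>x\<bar> = s \<longleftrightarrow> x\<^sup>2 = real k - 1"
      using s by (metis abs_of_nonneg power2_eq_iff_nonneg abs_ge_zero power2_abs)
    moreover have "\<bar>x\<bar> = real k \<longleftrightarrow> x\<^sup>2 = (real k)\<^sup>2"
      by (metis abs_ge_zero of_nat_0_le_iff power2_abs power2_eq_iff_nonneg)
    ultimately show "?g x = 0 \<longleftrightarrow> (x\<^sup>2 - (real k - 1)) * (x\<^sup>2 - (real k)\<^sup>2) = 0" by simp
  qed
  finally show "eps = B \<longleftrightarrow> four_cycle_free \<and> near_transitive"
    unfolding excess_eq_0_iff using spectrum_near_transitive_iff[OF _ xs] by blast
qed

end

section \<open>Graphs with unique and transitive common neighbours\<close>

definition has_common_nbr :: "('a \<times> 'a) set \<Rightarrow> 'a \<Rightarrow> 'a \<Rightarrow> bool" where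
  "has_common_nbr E u v \<longleftrightarrow> (\<exists>x. (u, x) \<in> E \<and> (v, x) \<in> E)"

text \<open>The equality condition in terms of arcs alone, without vertex set or degree. In this
  form it passes along isomorphisms and to disjoint unions.\<close>

definition partial_plane :: "('a \<times> 'a) set \<Rightarrow> bool" where
  "partial_plane E \<longleftrightarrow>
     (\<forall>u v x y. (u, x) \<in> E \<and> (v, x) \<in> E \<and> (u, y) \<in> E \<and> (v, y) \<in> E \<longrightarrow> u = v \<or> x = y) \<and>
     (\<forall>u v w. has_common_nbr E u v \<and> has_common_nbr E v w \<longrightarrow> u = w \<or> has_common_nbr E u w)"

lemma partial_plane_rectangle:
  "partial_plane E \<Longrightarrow> (u, x) \<in> E \<Longrightarrow> (v, x) \<in> E \<Longrightarrow> (u, y) \<in> E \<Longrightarrow> (v, y) \<in> E \<Longrightarrow> u = v \<or> x = y"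
  unfolding partial_plane_def by blast

lemma partial_plane_common_trans:
  "partial_plane E \<Longrightarrow> has_common_nbr E u v \<Longrightarrow> has_common_nbr E v w \<Longrightarrow> u = w \<or> has_common_nbr E u w"
  unfolding partial_plane_def by blast

section \<open>Invariance under isomorphism and disjoint union\<close>

lemma digraph_iso_with_projI:
  assumes "parcs H \<subseteq> pverts H \<times> pverts H" "inj_on f (pverts H)"
    and "pverts K = f ` pverts H" "parcs K = map_prod f f ` parcs H"
  shows "digraph_iso (with_proj H) (with_proj K)"
proof -
  let ?hom = "\<lparr> iso_verts = f, iso_arcs = map_prod f f, iso_head = snd, iso_tail = fst \<rparr>"
  have "wf_digraph (with_proj H)" using assms(1) by unfold_locales auto
  moreover have "inj_on (map_prod f f) (parcs H)"
    using map_prod_inj_on[OF assms(2,2)] inj_on_subset assms(1) by blast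
  ultimately have "pre_digraph.digraph_isomorphism (with_proj H) ?hom"
    using assms(2) by (auto simp: pre_digraph.digraph_isomorphism_def)
  moreover have "with_proj K = app_iso ?hom (with_proj H)"
    using assms(3,4) by (simp add: with_proj_def app_iso_def)
  ultimately show ?thesis unfolding digraph_iso_def by blast
qed

text \<open>An isomorphism has separate maps for vertices, arcs, heads and tails. As heads and tails
  are projections of pairs on both sides, the vertex map forces the arc map.\<close>

lemma digraph_iso_with_projE:
  assumes "digraph_iso (with_proj H) (with_proj K)"
  obtains f where "parcs H \<subseteq> pverts H \<times> pverts H" "inj_on f (pverts H)"
    "pverts K = f ` pverts H" "parcs K = map_prod f f ` parcs H"
proof -
  obtain h where h: "pre_digraph.digraph_isomorphism (with_proj H) h"
    "with_proj K = app_iso h (with_proj H)"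
    using assms unfolding digraph_iso_def by blast
  have K: "pverts K = iso_verts h ` pverts H" "parcs K = iso_arcs h ` parcs H"
    "fst = iso_tail h" "snd = iso_head h"
    using h(2) by (auto simp: with_proj_def app_iso_def)
  have wf: "pair_wf_digraph H" and inj: "inj_on (iso_verts h) (pverts H)"
    and arcs: "\<forall>a\<in>parcs H. iso_verts h (fst a) = iso_tail h (iso_arcs h a) \<and>
      iso_verts h (snd a) = iso_head h (iso_arcs h a)"
    using h(1) by (auto simp: pre_digraph.digraph_isomorphism_def wf_digraph_wp_iff)
  have "iso_arcs h e = map_prod (iso_verts h) (iso_verts h) e" if "e \<in> parcs H" for e
    using arcs that unfolding K(3,4)[symmetric] by (cases e, cases "iso_arcs h e") force
  hence "parcs K = map_prod (iso_verts h) (iso_verts h) ` parcs H" unfolding K(2) by (rule image_cong[OF refl])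
  moreover have "parcs H \<subseteq> pverts H \<times> pverts H"
    using pair_wf_digraph.arc_fst_in_verts[OF wf] pair_wf_digraph.arc_snd_in_verts[OF wf] by fastforce
  ultimately show ?thesis using that inj K(1) by blast
qed

lemma partial_plane_iso:
  assumes iso: "digraph_iso (with_proj H) (with_proj K)" and K: "partial_plane (parcs K)"
  shows "partial_plane (parcs H)"
proof -
  obtain f where f: "parcs H \<subseteq> pverts H \<times> pverts H" "inj_on f (pverts H)"
    "pverts K = f ` pverts H" "parcs K = map_prod f f ` parcs H"
    using iso by (rule digraph_iso_with_projE)
  have arc: "(u, v) \<in> parcs H \<longleftrightarrow> (f u, f v) \<in> parcs K" if uv: "u \<in> pverts H" "v \<in> pverts H" for u v
  proof
    assume "(f u, f v) \<in> parcs K"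
    then obtain x y where xy: "(x, y) \<in> parcs H" "f x = f u" "f y = f v" unfolding f(4) by auto
    moreover have "x \<in> pverts H" "y \<in> pverts H" using xy(1) f(1) by auto
    ultimately show "(u, v) \<in> parcs H" using uv by (simp add: inj_on_eq_iff[OF f(2)])
  qed (force simp: f(4))
  have V: "u \<in> pverts H" "v \<in> pverts H" if "(u, v) \<in> parcs H" for u v using that f(1) by auto
  have eq: "u = v \<longleftrightarrow> f u = f v" if "u \<in> pverts H" "v \<in> pverts H" for u v
    using that inj_on_eq_iff[OF f(2)] by simp
  \<comment> \<open>A common neighbour found in \<open>K\<close> has a preimage and can be pulled
    back to \<open>H\<close>.\<close>
  have arcs_K: "\<exists>v\<in>pverts H. y = f v" if "(x, y) \<in> parcs K" for x y
    using that f(1) unfolding f(4) by auto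
  have common: "has_common_nbr (parcs H) u v \<longleftrightarrow> has_common_nbr (parcs K) (f u) (f v)"
    if "u \<in> pverts H" "v \<in> pverts H" for u v
    using that unfolding has_common_nbr_def by (metis arc arcs_K V)
  have commonV: "u \<in> pverts H \<and> v \<in> pverts H" if "has_common_nbr (parcs H) u v" for u v
    using that V unfolding has_common_nbr_def by blast
  show ?thesis unfolding partial_plane_def
  proof (intro conjI allI impI)
    fix u v x y
    assume A: "(u, x) \<in> parcs H \<and> (v, x) \<in> parcs H \<and> (u, y) \<in> parcs H \<and> (v, y) \<in> parcs H"
    have V': "u \<in> pverts H" "v \<in> pverts H" "x \<in> pverts H" "y \<in> pverts H" using A V by auto
    have "f u = f v \<or> f x = f y"
      using A V' by (intro partial_plane_rectangle[OF K]) (simp_all flip: arc)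
    thus "u = v \<or> x = y" using V' by (simp add: eq)
  next
    fix u v w
    assume A: "has_common_nbr (parcs H) u v \<and> has_common_nbr (parcs H) v w"
    have V': "u \<in> pverts H" "v \<in> pverts H" "w \<in> pverts H" using A commonV by auto
    have "f u = f w \<or> has_common_nbr (parcs K) (f u) (f w)"
      using A V' by (intro partial_plane_common_trans[OF K, of _ "f v"]) (simp_all flip: common)
    thus "u = w \<or> has_common_nbr (parcs H) u w" using V' by (simp add: eq common)
  qed
qed

text \<open>Members share no vertices and keep their arcs inside, so a rectangle or a chain of
  common neighbours lies in the one member that contains its first vertex.\<close>

lemma partial_plane_disjoint_union:
  assumes G: "disjoint_union_of Q G"
    and Q: "\<And>H. Q H \<Longrightarrow> parcs H \<subseteq> pverts H \<times> pverts H \<and> partial_plane (parcs H)"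
  shows "partial_plane (parcs G)"
proof -
  obtain C where C0: "\<forall>H\<in>C. Q H" and disj: "disjoint_family_on pverts C" and G_eq: "parcs G = (\<Union>H\<in>C. parcs H)"
    using G unfolding disjoint_union_of_def by (elim exE conjE) blast
  have C: "parcs H \<subseteq> pverts H \<times> pverts H" "partial_plane (parcs H)" if "H \<in> C" for H
    using C0 Q that by auto
  have same: "(u, v) \<in> parcs H" if A: "(u, v) \<in> parcs G" "H \<in> C" "u \<in> pverts H \<or> v \<in> pverts H" for u v H
  proof -
    obtain H' where H': "H' \<in> C" "(u, v) \<in> parcs H'" using A(1) unfolding G_eq by blast
    hence "u \<in> pverts H'" "v \<in> pverts H'" using C(1)[OF H'(1)] by auto
    moreover have "pverts H' \<inter> pverts H = {}" if "H' \<noteq> H"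
      using disj H'(1) \<open>H \<in> C\<close> that unfolding disjoint_family_on_def by simp
    ultimately have "H' = H" using A(3) by blast
    thus ?thesis using H' by simp
  qed
  have common: "has_common_nbr (parcs H) u v" "v \<in> pverts H"
    if A: "has_common_nbr (parcs G) u v" and HC: "H \<in> C" "u \<in> pverts H" for u v H
  proof -
    obtain x where x: "(u, x) \<in> parcs G" "(v, x) \<in> parcs G" using A unfolding has_common_nbr_def by blast
    have "(u, x) \<in> parcs H" using same x(1) HC by blast
    moreover have "(v, x) \<in> parcs H" using same[OF x(2) HC(1)] calculation C(1)[OF HC(1)] by blast
    ultimately show "has_common_nbr (parcs H) u v" "v \<in> pverts H"
      using C(1)[OF HC(1)] unfolding has_common_nbr_def by auto
  qed
  have H: "\<exists>H\<in>C. u \<in> pverts H" if "(u, v) \<in> parcs G" for u v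
    using that C(1) unfolding G_eq by blast
  show ?thesis unfolding partial_plane_def
  proof (intro conjI allI impI)
    fix u v x y
    assume A: "(u, x) \<in> parcs G \<and> (v, x) \<in> parcs G \<and> (u, y) \<in> parcs G \<and> (v, y) \<in> parcs G"
    then obtain H where HC: "H \<in> C" "u \<in> pverts H" using H by blast
    note Hp = C[OF HC(1)]
    have "(u, x) \<in> parcs H" "(u, y) \<in> parcs H" using A same HC by blast+
    moreover from this have "(v, x) \<in> parcs H" "(v, y) \<in> parcs H" using A same HC(1) Hp(1) by blast+
    ultimately show "u = v \<or> x = y" using partial_plane_rectangle[OF Hp(2)] by blast
  next
    fix u v w
    assume A: "has_common_nbr (parcs G) u v \<and> has_common_nbr (parcs G) v w"
    then obtain H where HC: "H \<in> C" "u \<in> pverts H" using H unfolding has_common_nbr_def by blast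
    have uv: "has_common_nbr (parcs H) u v" and v: "v \<in> pverts H" using common A HC by auto
    have "has_common_nbr (parcs H) v w" using common(1)[OF _ HC(1) v] A by blast
    hence "u = w \<or> has_common_nbr (parcs H) u w"
      using partial_plane_common_trans[OF C(2)[OF HC(1)]] uv by blast
    thus "u = w \<or> has_common_nbr (parcs G) u w" using HC(1) unfolding has_common_nbr_def G_eq by blast
  qed
qed

text \<open>Two points on two common lines contradict uniqueness of the join. Common neighbours link
  only elements of the same kind, and by the axioms any two distinct ones, whence
  transitivity.\<close>

lemma partial_plane_incidence_graph:
  assumes "projective_plane P L I"
  shows "partial_plane (parcs (incidence_graph P L I))"
proof -
  have sub: "I \<subseteq> P \<times> L"
    and pl: "\<forall>p\<in>P. \<forall>q\<in>P. p \<noteq> q \<longrightarrow> (\<exists>!l. l \<in> L \<and> (p, l) \<in> I \<and> (q, l) \<in> I)"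
    and lp: "\<forall>l\<in>L. \<forall>m\<in>L. l \<noteq> m \<longrightarrow> (\<exists>!p. p \<in> P \<and> (p, l) \<in> I \<and> (p, m) \<in> I)"
    using assms unfolding projective_plane_def by auto
  let ?E = "parcs (incidence_graph P L I)"
  have E: "(Inl p, y) \<in> ?E \<longleftrightarrow> (\<exists>l. y = Inr l \<and> (p, l) \<in> I)"
    "(Inr l, y) \<in> ?E \<longleftrightarrow> (\<exists>p. y = Inl p \<and> (p, l) \<in> I)" for p l y
    by (auto simp: incidence_graph_def)
  have I: "p \<in> P" "l \<in> L" if "(p, l) \<in> I" for p l using that sub by auto
  have pts: "p = q \<or> l = m" if "(p, l) \<in> I" "(q, l) \<in> I" "(p, m) \<in> I" "(q, m) \<in> I" for p q l m
    proof (rule ccontr)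
    assume *: "\<not> (p = q \<or> l = m)"
    have "\<exists>!l. l \<in> L \<and> (p, l) \<in> I \<and> (q, l) \<in> I" using pl * I that by blast
    thus False using * I that by blast
  qed
  have join: "\<exists>l. (p, l) \<in> I \<and> (q, l) \<in> I" if "p \<in> P" "q \<in> P" "p \<noteq> q" for p q
    using ex1_implies_ex[OF pl[rule_format, OF that]] by blast
  have meet: "\<exists>p. (p, l) \<in> I \<and> (p, m) \<in> I" if "l \<in> L" "m \<in> L" "l \<noteq> m" for l m
    using ex1_implies_ex[OF lp[rule_format, OF that]] by blast
  have common: "has_common_nbr ?E (Inl p) (Inl q) \<longleftrightarrow> (\<exists>l. (p, l) \<in> I \<and> (q, l) \<in> I)"
    "has_common_nbr ?E (Inr l) (Inr m) \<longleftrightarrow> (\<exists>p. (p, l) \<in> I \<and> (p, m) \<in> I)"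
    "\<not> has_common_nbr ?E (Inl p) (Inr l)" "\<not> has_common_nbr ?E (Inr l) (Inl p)" for p q l m
    unfolding has_common_nbr_def E by auto
  show ?thesis unfolding partial_plane_def
  proof (intro conjI allI impI)
    fix u v x y
    assume "(u, x) \<in> ?E \<and> (v, x) \<in> ?E \<and> (u, y) \<in> ?E \<and> (v, y) \<in> ?E"
    thus "u = v \<or> x = y" by (cases u; cases v) (auto simp: E dest: pts)
  next
    fix u v w
    assume A: "has_common_nbr ?E u v \<and> has_common_nbr ?E v w"
    show "u = w \<or> has_common_nbr ?E u w"
    proof (cases u)
      case u: (Inl p)
      then obtain q where "v = Inl q" using A common by (cases v) auto
      then obtain r where w: "w = Inl r" using A common by (cases w) auto
      have "p \<in> P" "r \<in> P" using A I unfolding u w \<open>v = Inl q\<close> common by blast+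
      then show ?thesis using join[of p r] unfolding u w common by blast
    next
      case u: (Inr l)
      then obtain m where "v = Inr m" using A common by (cases v) auto
      then obtain r where w: "w = Inr r" using A common by (cases w) auto
      have "l \<in> L" "r \<in> L" using A I unfolding u w \<open>v = Inr m\<close> common by blast+
      then show ?thesis using meet[of l r] unfolding u w common by blast
    qed
  qed
qed

context enumerated_regular_graph
begin

text \<open>The traces of \<open>A\<close> and \<open>A\<^sup>3\<close> show that the eigenvalues \<open>\<plusminus>sqrt (k - 1)\<close> alone sum to \<open>- k\<close>. Hence
  \<open>k - 1\<close> divides \<open>k\<^sup>2 = (k - 1) * (k + 1) + 1\<close>.\<close>

lemma degree_if_all_near:
  assumes k: "k \<ge> 2" and V: "V \<noteq> {}" and four_cycle_free
    and near: "\<And>u v. u \<in> V \<Longrightarrow> v \<in> V \<Longrightarrow> near u v"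
  shows "k = 2"
proof -
  obtain xs where xs: "is_spectrum xs" using is_spectrum_exists ..
  define s where "s = sqrt (real k - 1)"
  have s: "s > 0" "s\<^sup>2 = real k - 1" using k by (auto simp: s_def)
  define m where "m = (real k)\<^sup>2 - real k + 1"
  have m: "m = (real k)\<^sup>2 - s\<^sup>2" by (simp add: m_def s)
  obtain u where "u \<in> V" using V by blast
  hence "{v. near u v} = V" using near by (auto dest: near_V)
  hence card: "real (card V) = m"
    using card_near[OF \<open>four_cycle_free\<close> \<open>u \<in> V\<close>] by (simp add: m_def)
  have "m > 0" using card V finite_V by (metis card_gt_0_iff of_nat_0_less_iff)
  have "near_transitive" unfolding near_transitive_def using near near_V by blast
  hence roots: "x\<^sup>2 = s\<^sup>2 \<or> x\<^sup>2 = (real k)\<^sup>2" if "x \<in> set xs" for x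
    using spectrum_near_transitive_iff[OF \<open>four_cycle_free\<close> xs] that by (auto simp: s)
  \<comment> \<open>The sign of the eigenvalues \<open>s\<close> and \<open>- s\<close>; it is 0 at
    those of modulus \<open>k\<close>.\<close>
  define t :: "real \<Rightarrow> int" where "t x = (if x = s then 1 else if x = - s then - 1 else 0)" for x
  \<comment> \<open>The cubic k^2 x - x^3 vanishes at k and - k, which isolates the other
    eigenvalues.\<close>
  have t: "(real k)\<^sup>2 * x - x * (x * x) = m * s * of_int (t x)" if "x \<in> set xs" for x
  proof (cases "x\<^sup>2 = s\<^sup>2")
    case True
    hence "x = s \<or> x = - s" by (simp add: power2_eq_iff)
    moreover have "s \<noteq> - s" using s(1) by linarith
    ultimately show ?thesis by (auto simp: t_def m power2_eq_square algebra_simps)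
  next
    case False
    hence "t x = 0" "x\<^sup>2 = (real k)\<^sup>2" using roots[OF that] by (auto simp: t_def)
    then show ?thesis by (simp add: power2_eq_square mult.commute mult.left_commute)
  qed
  have "(\<Sum>x\<leftarrow>xs. x) = (\<Sum>v\<in>V. adj v v)"
    by (intro spectrum_trace[OF xs] adj_poly_adj)
  hence t1: "(\<Sum>x\<leftarrow>xs. x) = 0" by (simp add: adj_def E_irrefl)
  have "(\<Sum>x\<leftarrow>xs. x * (x * x)) = (\<Sum>v\<in>V. conv adj (conv adj adj) v v)"
    by (intro spectrum_trace[OF xs] adj_poly_conv adj_poly_adj)
  \<comment> \<open>Adjacent vertices have exactly one common neighbour, so the diagonal of A^3
    counts neighbours.\<close>
  also have "\<dots> = (\<Sum>v\<in>V. \<Sum>w\<in>V. adj v w)"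
    unfolding conv_adj unfolding conv_def
  proof (intro sum.cong refl)
    fix v w assume "v \<in> V" "w \<in> V"
    thus "adj v w * codeg w v = adj v w"
      using near E_irrefl[of v] by (cases "v = w") (simp_all add: adj_def codeg_near[OF \<open>four_cycle_free\<close>])
  qed
  finally have t3: "(\<Sum>x\<leftarrow>xs. x * (x * x)) = m * real k" by (simp add: sum_adj card)
  have "(\<Sum>x\<leftarrow>xs. (real k)\<^sup>2 * x - x * (x * x)) = (real k)\<^sup>2 * (\<Sum>x\<leftarrow>xs. x) - (\<Sum>x\<leftarrow>xs. x * (x * x))"
    by (induction xs) (simp_all add: algebra_simps)
  hence "(\<Sum>x\<leftarrow>xs. m * s * of_int (t x)) = - (m * real k)"
    using t t1 t3 by (simp cong: map_cong)
  moreover have "(\<Sum>x\<leftarrow>xs. m * s * of_int (t x)) = m * (s * of_int (\<Sum>x\<leftarrow>xs. t x))"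
    by (induction xs) (simp_all add: algebra_simps)
  ultimately have "m * (s * of_int (\<Sum>x\<leftarrow>xs. t x)) = m * (- real k)" by simp
  hence "s * of_int (\<Sum>x\<leftarrow>xs. t x) = - real k" using \<open>m > 0\<close> by (subst (asm) mult_cancel_left) simp
  \<comment> \<open>Squaring replaces the possibly irrational \<open>s\<close> by
    \<open>k - 1\<close> and leaves an equation between integers.\<close>
  hence "(s * of_int (\<Sum>x\<leftarrow>xs. t x))\<^sup>2 = (real k)\<^sup>2" by simp
  hence "real_of_int ((int k - 1) * (\<Sum>x\<leftarrow>xs. t x)\<^sup>2) = real_of_int ((int k)\<^sup>2)"
    by (simp add: power_mult_distrib s)
  hence "(int k - 1) * (\<Sum>x\<leftarrow>xs. t x)\<^sup>2 = (int k)\<^sup>2" by (simp only: of_int_eq_iff)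
  hence "int k - 1 dvd (int k)\<^sup>2" by (metis dvd_triv_left)
  moreover have "(int k)\<^sup>2 = (int k - 1) * (int k + 1) + 1" by (simp add: power2_eq_square algebra_simps)
  ultimately have "int k - 1 dvd 1" by (metis dvd_add_right_iff dvd_triv_left)
  thus "k = 2" using k by simp
qed

end

text \<open>Vertices outside \<open>V\<close> have no neighbours, so quantifiers over the whole type
  and over \<open>V\<close> agree. A bound of 1 on the number of common neighbours is their
  uniqueness.\<close>

lemma (in regular_graph) partial_plane_iff:
  "partial_plane E \<longleftrightarrow> four_cycle_free \<and> near_transitive"
proof -
  have near: "near u v \<longleftrightarrow> u \<in> V \<and> v \<in> V \<and> (u = v \<or> has_common_nbr E u v)" for u v
    unfolding near_def has_common_nbr_def by auto
  have "card (E `` {u} \<inter> E `` {v}) \<le> 1 \<longleftrightarrow>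
    (\<forall>x y. (u, x) \<in> E \<and> (v, x) \<in> E \<and> (u, y) \<in> E \<and> (v, y) \<in> E \<longrightarrow> x = y)" for u v
    using card_le_Suc0_iff_eq[of "E `` {u} \<inter> E `` {v}"] finite_nbrs[of u] by auto
  hence "four_cycle_free \<longleftrightarrow> (\<forall>u v x y. (u, x) \<in> E \<and> (v, x) \<in> E \<and> (u, y) \<in> E \<and> (v, y) \<in> E \<longrightarrow> u = v \<or> x = y)"
    unfolding four_cycle_free_def using E_V by blast
  moreover have "near_transitive \<longleftrightarrow>
    (\<forall>u v w. has_common_nbr E u v \<and> has_common_nbr E v w \<longrightarrow> u = w \<or> has_common_nbr E u w)"
  proof -
    have "u \<in> V \<and> v \<in> V" if "has_common_nbr E u v" for u v
      using that E_V unfolding has_common_nbr_def by blast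
    thus ?thesis unfolding near_transitive_def near by blast
  qed
  ultimately show ?thesis unfolding partial_plane_def by blast
qed

section \<open>The triangle and the hexagon\<close>

lemma parcs_cycle_graph_eqI:
  assumes "C \<subseteq> set [0..<n] \<times> set [0..<n]"
    and "\<forall>i\<in>set [0..<n]. \<forall>j\<in>set [0..<n]. (j = (i + 1) mod n \<or> i = (j + 1) mod n) \<longleftrightarrow> (i, j) \<in> C"
  shows "parcs (cycle_graph n) = C"
proof -
  have "i < n \<and> j < n \<and> (j = (i + 1) mod n \<or> i = (j + 1) mod n) \<longleftrightarrow> (i, j) \<in> C" for i j
    using assms unfolding set_upt by (cases "i < n \<and> j < n") auto
  thus ?thesis unfolding cycle_graph_def by auto
qed

lemma parcs_cycle_graph_3:
  "parcs (cycle_graph 3) =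
     {(0, 1), (1, 0), (1, 2), (2, 1), (2, 0), (0, 2)}"
  \<comment> \<open>Quantifiers over \<open>set [0..<n]\<close> are executable, so evaluation
    decides the claim.\<close>
  by (rule parcs_cycle_graph_eqI; code_simp)

lemma parcs_cycle_graph_6:
  "parcs (cycle_graph 6) =
     {(0, 1), (1, 0), (1, 2), (2, 1), (2, 3), (3, 2), (3, 4), (4, 3), (4, 5), (5, 4), (5, 0), (0, 5)}"
  by (rule parcs_cycle_graph_eqI; code_simp)

lemma partial_plane_cycle_graph_3: "partial_plane (parcs (cycle_graph 3))"
  unfolding partial_plane_def has_common_nbr_def parcs_cycle_graph_3 by auto

lemma cycle_graph_6_parity: "(u, v) \<in> parcs (cycle_graph 6) \<Longrightarrow> u < 6 \<and> odd (u + v)"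
  unfolding parcs_cycle_graph_6 by auto

text \<open>Arcs of the hexagon change parity, and two vertices of equal parity are equal or two
  steps apart. With this form, transitivity becomes addition of parities.\<close>

lemma has_common_nbr_cycle_graph_6:
  "has_common_nbr (parcs (cycle_graph 6)) u v \<longleftrightarrow> u < 6 \<and> v < 6 \<and> even (u + v)"
proof
  assume "has_common_nbr (parcs (cycle_graph 6)) u v"
  thus "u < 6 \<and> v < 6 \<and> even (u + v)"
    unfolding has_common_nbr_def by (auto dest!: cycle_graph_6_parity)
next
  assume "u < 6 \<and> v < 6 \<and> even (u + v)"
  hence "u \<in> {0, 2, 4} \<and> v \<in> {0, 2, 4} \<or> u \<in> {1, 3, 5} \<and> v \<in> {1, 3, 5}"
    by simp presburger
  moreover have "has_common_nbr (parcs (cycle_graph 6)) u v" if "{(u, x), (v, x)} \<subseteq> parcs (cycle_graph 6)" for x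
    using that unfolding has_common_nbr_def by auto
  \<comment> \<open>Each of the six vertices is offered as a candidate for the common
    neighbour.\<close>
  note this[of 0] this[of 1] this[of 2] this[of 3] this[of 4] this[of 5]
  ultimately show "has_common_nbr (parcs (cycle_graph 6)) u v"
    unfolding parcs_cycle_graph_6 by (elim disjE conjE insertE emptyE; simp)
qed

lemma partial_plane_cycle_graph_6: "partial_plane (parcs (cycle_graph 6))"
  unfolding partial_plane_def has_common_nbr_cycle_graph_6
proof (intro conjI allI impI)
  fix u v x y
  assume A: "(u, x) \<in> parcs (cycle_graph 6) \<and> (v, x) \<in> parcs (cycle_graph 6) \<and>
    (u, y) \<in> parcs (cycle_graph 6) \<and> (v, y) \<in> parcs (cycle_graph 6)"
  hence "(u, x) \<in> parcs (cycle_graph 6)" by blast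
  thus "u = v \<or> x = y"
    using A unfolding parcs_cycle_graph_6 by (elim insertE) auto
qed auto

section \<open>Components in the equality case\<close>

locale partial_plane_graph = regular_graph +
  assumes k_ge_2: "k \<ge> 2" and partial_plane_E: "partial_plane E"
begin

lemma four_cycle_free: four_cycle_free
  using partial_plane_E partial_plane_iff by blast

lemma near_trans: "near u v \<Longrightarrow> near v w \<Longrightarrow> near u w"
  using partial_plane_E partial_plane_iff unfolding near_transitive_def by blast

lemma nbr_exists:
  assumes "u \<in> V"
  obtains w where "(u, w) \<in> E"
proof -
  have "E `` {u} \<noteq> {}" using card_nbrs[OF assms] k_ge_2 by auto
  thus ?thesis using that by blast
qed

lemma near_common: "(u, x) \<in> E \<Longrightarrow> (v, x) \<in> E \<Longrightarrow> near u v"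
  unfolding near_def using E_V by blast

text \<open>If \<open>y\<close> is a common neighbour of \<open>u\<close> and \<open>v\<close>, then
  \<open>w\<close> and \<open>y\<close> share \<open>u\<close>, while \<open>y\<close> and
  \<open>x\<close> share \<open>v\<close>; transitivity joins them.\<close>

lemma near_step:
  assumes "near u v" "(u, w) \<in> E" "(v, x) \<in> E"
  shows "near w x"
proof (cases "u = v")
  case True
  then show ?thesis using near_common[of w u x] assms E_commute by blast
next
  case False
  then obtain y where "(u, y) \<in> E" "(v, y) \<in> E" using assms(1) unfolding near_def by blast
  hence "near w y" "near y x" using near_common assms E_commute by blast+
  thus ?thesis by (rule near_trans)
qed

lemma common_nbr_unique: "(u, x) \<in> E \<Longrightarrow> (v, x) \<in> E \<Longrightarrow> (u, y) \<in> E \<Longrightarrow> (v, y) \<in> E \<Longrightarrow> u \<noteq> v \<Longrightarrow> x = y"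
  using partial_plane_rectangle[OF partial_plane_E] by blast

lemma common_nbr_ex1:
  assumes "near u v" "u \<noteq> v"
  shows "\<exists>!x. (u, x) \<in> E \<and> (v, x) \<in> E"
  using assms common_nbr_unique unfolding near_def by blast

text \<open>Membership in the class of the neighbours of \<open>u\<close>. By
  \<open>near_step\<close> all neighbours of vertices near \<open>u\<close> lie in this single
  class.\<close>

definition opposite :: "'a \<Rightarrow> 'a \<Rightarrow> bool" where
  "opposite u v \<longleftrightarrow> (\<exists>w. (u, w) \<in> E \<and> near w v)"

text \<open>Arcs from either of the two classes lead to the other, so this is the connected
  component of \<open>u\<close>.\<close>

definition component :: "'a \<Rightarrow> 'a pair_pre_digraph" where
  "component u =
     (let U = {v. near u v \<or> opposite u v} in \<lparr> pverts = U, parcs = E \<inter> U \<times> U \<rparr>)"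

lemma pverts_component: "pverts (component u) = {v. near u v \<or> opposite u v}"
  and parcs_component:
    "parcs (component u) = E \<inter> {v. near u v \<or> opposite u v} \<times> {v. near u v \<or> opposite u v}"
  by (simp_all add: component_def Let_def)

lemma near_arc:
  assumes "near u v" "(v, w) \<in> E"
  shows "opposite u w"
proof -
  obtain x where "(u, x) \<in> E" using nbr_exists near_V(1)[OF assms(1)] .
  thus ?thesis unfolding opposite_def using near_step[OF assms(1) _ assms(2)] by blast
qed

lemma opposite_arc:
  assumes "opposite u v" "(v, w) \<in> E"
  shows "near u w"
proof -
  obtain x where "(u, x) \<in> E" "near x v" using assms(1) unfolding opposite_def by blast
  thus ?thesis using near_step[of x v u w] assms(2) E_commute[of u x] by blast
qed

lemma opposite_near: "opposite u v \<Longrightarrow> near v w \<Longrightarrow> opposite u w"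
  unfolding opposite_def using near_trans by blast

lemma near_opposite:
  assumes "near u v" "opposite v w"
  shows "opposite u w"
proof -
  obtain x where "(v, x) \<in> E" "near x w" using assms(2) unfolding opposite_def by blast
  thus ?thesis using opposite_near[OF near_arc[OF assms(1)]] by blast
qed

lemma opposite_sym:
  assumes "opposite u v"
  shows "opposite v u"
proof -
  obtain x where x: "(u, x) \<in> E" "near x v" using assms unfolding opposite_def by blast
  have "(x, u) \<in> E" using x(1) E_commute by blast
  thus ?thesis by (rule near_arc[OF near_sym[OF x(2)]])
qed

lemma opposite_opposite:
  assumes "opposite u v" "opposite v w"
  shows "near u w"
proof -
  obtain x where "(v, x) \<in> E" "near x w" using assms(2) unfolding opposite_def by blast
  thus ?thesis using near_trans[OF opposite_arc[OF assms(1)]] by blast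
qed

lemma opposite_V: "opposite u v \<Longrightarrow> u \<in> V" "opposite u v \<Longrightarrow> v \<in> V"
  unfolding opposite_def using E_V near_V by blast+

text \<open>Starting from a near vertex keeps the two classes, and starting from an opposite one
  exchanges them.\<close>

lemma component_eq:
  assumes "v \<in> pverts (component u)"
  shows "component v = component u"
proof -
  have "near v w \<or> opposite v w \<longleftrightarrow> near u w \<or> opposite u w" for w
  proof -
    have "near u v \<or> opposite u v" using assms by (simp add: pverts_component)
    thus ?thesis
    proof
      assume uv: "near u v"
      show ?thesis
        using near_trans[OF uv, of w] near_trans[OF near_sym[OF uv], of w]
          near_opposite[OF uv, of w] near_opposite[OF near_sym[OF uv], of w] by blast
    next
      assume uv: "opposite u v"
      show ?thesis
        using opposite_near[OF uv, of w] opposite_near[OF opposite_sym[OF uv], of w]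
          opposite_opposite[OF uv, of w] opposite_opposite[OF opposite_sym[OF uv], of w] by blast
    qed
  qed
  thus ?thesis unfolding component_def by simp
qed

text \<open>The components are collected as a set, so disjointness of distinct members is
  \<open>component_eq\<close>.\<close>

lemma disjoint_union_of_components:
  assumes "pverts G = V" "parcs G = E" and Q: "\<And>u. u \<in> V \<Longrightarrow> Q (component u)"
  shows "disjoint_union_of Q G"
  unfolding disjoint_union_of_def
proof (intro exI[of _ "component ` V"] conjI)
  show "\<forall>H\<in>component ` V. Q H" using Q by blast
  show "disjoint_family_on pverts (component ` V)"
    unfolding disjoint_family_on_def
  proof (intro ballI impI)
    fix H K assume "H \<in> component ` V" "K \<in> component ` V" and "H \<noteq> K"
    then obtain u v where "H = component u" "K = component v" by blast
    hence "x \<notin> pverts H \<or> x \<notin> pverts K" for x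
      using component_eq[of x u] component_eq[of x v] \<open>H \<noteq> K\<close> by metis
    thus "pverts H \<inter> pverts K = {}" by blast
  qed
  have self: "u \<in> pverts (component u)" if "u \<in> V" for u
    using near_refl[OF that] by (simp add: pverts_component)
  show "pverts G = (\<Union>H\<in>component ` V. pverts H)"
    unfolding assms(1) using self near_V opposite_V by (auto simp: pverts_component)
  have "(u, v) \<in> parcs (component u)" if "(u, v) \<in> E" for u v
    using that near_refl[OF E_V(1)[OF that]] near_arc by (auto simp: parcs_component)
  hence "(u, v) \<in> (\<Union>H\<in>component ` V. parcs H)" if "(u, v) \<in> E" for u v
    using that E_V(1) by (intro UN_I[of "component u"]) auto
  hence "E \<subseteq> (\<Union>H\<in>component ` V. parcs H)" by (rule subrelI)
  moreover have "parcs H \<subseteq> E" if "H \<in> component ` V" for H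
    using that by (auto simp: parcs_component)
  hence "(\<Union>H\<in>component ` V. parcs H) \<subseteq> E" by (rule UN_least)
  ultimately show "parcs G = (\<Union>H\<in>component ` V. parcs H)" unfolding assms(2) by (rule subset_antisym)
qed

text \<open>One arc inside the near class of \<open>u\<close> forces all arcs from that class to
  stay inside. The class is then a \<open>k\<close>-regular graph with all pairs near, and
  \<open>degree_if_all_near\<close> applies to it.\<close>

lemma component_triangle:
  assumes "(u, w) \<in> E" "near u w"
  shows "k = 2 \<and> is_triangle (component u)"
proof -
  define S where "S = {v. near u v}"
  have u: "u \<in> V" using assms E_V by blast
  have near_S: "near x y" if "x \<in> S" "y \<in> S" for x y
    using that near_sym near_trans unfolding S_def by blast
  have closed: "y \<in> S" if "x \<in> S" "(x, y) \<in> E" for x y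
    using near_step[of u x w y] near_trans[OF assms(2)] that assms(1) unfolding S_def by blast
  have S_V: "S \<subseteq> V" unfolding S_def using near_V by blast
  have nbrs: "(E \<inter> S \<times> S) `` {x} = E `` {x}" if "x \<in> S" for x
    using closed that by auto
  have finS: "finite S" using S_V finite_V finite_subset by blast
  then obtain vs where vs: "set vs = S" "distinct vs" using finite_distinct_list by blast
  interpret F: enumerated_regular_graph S "E \<inter> S \<times> S" k vs
  proof
    show "sym (E \<inter> S \<times> S)" using sym_E by (auto simp: sym_def)
    show "irrefl (E \<inter> S \<times> S)" using irrefl_E by (auto simp: irrefl_def)
    show "card ((E \<inter> S \<times> S) `` {x}) = k" if "x \<in> S" for x
      using that S_V card_nbrs by (auto simp: nbrs)
  qed (use finS vs in auto)
  have "F.near x y" if "x \<in> S" "y \<in> S" for x y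
    using near_S[OF that] that unfolding F.near_def near_def by (simp add: nbrs)
  moreover have "F.four_cycle_free"
    using four_cycle_free S_V unfolding F.four_cycle_free_def four_cycle_free_def
    by (auto simp: nbrs)
  moreover have "S \<noteq> {}" using near_refl[OF u] unfolding S_def by blast
  ultimately have k: "k = 2" using F.degree_if_all_near[OF k_ge_2] by blast
  \<comment> \<open>The class has k^2 - k + 1 vertices; with three vertices and degree 2 it is
    complete.\<close>
  have "real (card S) = 3"
    using card_near[OF four_cycle_free u] unfolding S_def k by simp
  hence "card S = 3" by simp
  then obtain p q r where S: "S = {p, q, r}" and pqr: "p \<noteq> q" "q \<noteq> r" "p \<noteq> r"
    unfolding card_3_iff by blast
  have "E `` {x} = S - {x}" if "x \<in> S" for x
  proof (rule card_subset_eq)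
    show "E `` {x} \<subseteq> S - {x}" using closed that E_irrefl by blast
    show "card (E `` {x}) = card (S - {x})"
      using card_nbrs[of x] S_V that \<open>card S = 3\<close> k finS by (simp add: subset_iff)
  qed (use finS in simp)
  hence "(x, y) \<in> E \<longleftrightarrow> y \<in> S \<and> x \<noteq> y" if "x \<in> S" for x y
    using that by auto
  hence arcs: "E \<inter> S \<times> S = {(p, q), (q, p), (q, r), (r, q), (r, p), (p, r)}"
    using pqr unfolding S by auto
  have "near u v" if opp: "opposite u v" for v
  proof -
    obtain y where y: "(u, y) \<in> E" "near y v" using opp unfolding opposite_def by blast
    hence "near u y" using closed[of u y] near_refl[OF u] unfolding S_def by blast
    thus ?thesis using y(2) by (rule near_trans)
  qed
  hence U: "{v. near u v \<or> opposite u v} = S" unfolding S_def by blast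
  let ?f = "\<lambda>x. if x = p then 0 else if x = q then 1 else 2 :: nat"
  have "is_triangle (component u)"
    unfolding is_triangle_def
  proof (rule digraph_iso_with_projI[of _ ?f])
    show "inj_on ?f (pverts (component u))"
      unfolding pverts_component U S using pqr by (auto simp: inj_on_def)
    show "pverts (cycle_graph 3) = ?f ` pverts (component u)"
      unfolding pverts_component U S cycle_graph_def using pqr by auto
    show "parcs (cycle_graph 3) = map_prod ?f ?f ` parcs (component u)"
      unfolding parcs_component U arcs parcs_cycle_graph_3 using pqr by simp
  qed (simp add: pverts_component parcs_component)
  with k show ?thesis by simp
qed

text \<open>The class of \<open>u\<close> serves as points and the class of its neighbours as lines,
  with adjacency as incidence. Joins and meets are the unique common neighbours, and a line has
  \<open>k\<close> points, which is order \<open>k - 1\<close>.\<close>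

lemma component_projective_plane:
  assumes "k \<noteq> 2" "u \<in> V"
  shows "is_projective_plane_incidence_graph (k - 1) (component u)"
proof -
  define P where "P = {v. near u v}"
  define L where "L = {v. opposite u v}"
  define I where "I = E \<inter> P \<times> L"
  \<comment> \<open>A common element would put an arc inside the class of \<open>u\<close>, hence
    give \<open>k = 2\<close>.\<close>
  have disj: "P \<inter> L = {}"
  proof (rule ccontr)
    assume "P \<inter> L \<noteq> {}"
    then obtain w x where "near u x" "(u, w) \<in> E" "near w x" unfolding P_def L_def opposite_def by blast
    hence "near u w" using near_sym near_trans by blast
    thus False using component_triangle[OF \<open>(u, w) \<in> E\<close>] assms(1) by blast
  qed
  have PL: "y \<in> L" if "x \<in> P" "(x, y) \<in> E" for x y
    using that near_arc unfolding P_def L_def by blast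
  have LP: "y \<in> P" if "x \<in> L" "(x, y) \<in> E" for x y
    using that opposite_arc unfolding P_def L_def by blast
  have nearP: "near x y" if "x \<in> P" "y \<in> P" for x y
    using that near_sym near_trans unfolding P_def by blast
  have nearL: "near x y" if "x \<in> L" "y \<in> L" for x y
    using that opposite_sym opposite_opposite unfolding L_def by blast
  have I_P: "(p, l) \<in> I \<longleftrightarrow> (p, l) \<in> E" if "p \<in> P" for p l using that PL unfolding I_def by blast
  have I_L: "(p, l) \<in> I \<longleftrightarrow> (l, p) \<in> E" if "l \<in> L" for p l
    using that LP E_commute unfolding I_def by blast
  have join: "\<exists>!l. l \<in> L \<and> (p, l) \<in> I \<and> (q, l) \<in> I" if "p \<in> P" "q \<in> P" "p \<noteq> q" for p q
    using common_nbr_ex1[OF nearP[OF that(1,2)] that(3)] PL[OF that(1)] that by (auto simp: I_P)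
  have meet: "\<exists>!p. p \<in> P \<and> (p, l) \<in> I \<and> (p, m) \<in> I" if "l \<in> L" "m \<in> L" "l \<noteq> m" for l m
    using common_nbr_ex1[OF nearL[OF that(1,2)] that(3)] LP[OF that(1)] that by (auto simp: I_L)
  have line: "{p \<in> P. (p, l) \<in> I} = E `` {l}" if "l \<in> L" for l
    using that LP by (auto simp: I_L)
  have card_line: "card {p \<in> P. (p, l) \<in> I} = k - 1 + 1" if "l \<in> L" for l
    using that card_nbrs[of l] opposite_V k_ge_2 unfolding line[OF that] by (simp add: L_def)
  \<comment> \<open>The quadrangle consists of two further points on each of two lines through
    \<open>u\<close>.\<close>
  have quad: "\<exists>Q\<subseteq>P. card Q = 4 \<and> (\<forall>l\<in>L. card {p \<in> Q. (p, l) \<in> I} \<le> 2)"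
  proof -
    have u: "u \<in> P" using near_refl[OF assms(2)] unfolding P_def by simp
    have "2 \<le> card (E `` {u})" using card_nbrs[OF assms(2)] k_ge_2 by simp
    then obtain A where "A \<subseteq> E `` {u}" "card A = 2" using obtain_subset_with_card_n by metis
    then obtain l m where lm: "(u, l) \<in> E" "(u, m) \<in> E" "l \<noteq> m" unfolding card_2_iff by blast
    have two: "\<exists>a b. (l, a) \<in> E \<and> (l, b) \<in> E \<and> a \<noteq> b \<and> a \<noteq> u \<and> b \<noteq> u" if "(u, l) \<in> E" for l
    proof -
      \<comment> \<open>Here \<open>k\<close> is at least 3, so a line through \<open>u\<close> has
        two more points.\<close>
      have "2 \<le> card (E `` {l} - {u})"
        using card_nbrs[of l] E_V that E_commute k_ge_2 assms(1) by (simp add: card_Diff_singleton)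
      then obtain A where "A \<subseteq> E `` {l} - {u}" "card A = 2" using obtain_subset_with_card_n by metis
      thus ?thesis unfolding card_2_iff by blast
    qed
    obtain a b where ab: "(l, a) \<in> E" "(l, b) \<in> E" "a \<noteq> b" "a \<noteq> u" "b \<noteq> u" using two[OF lm(1)] by blast
    obtain c d where cd: "(m, c) \<in> E" "(m, d) \<in> E" "c \<noteq> d" "c \<noteq> u" "d \<noteq> u" using two[OF lm(2)] by blast
    have lmL: "l \<in> L" "m \<in> L" using PL u lm by blast+
    have lm_u: "z = u" if "(l, z) \<in> E" "(m, z) \<in> E" for z
      using common_nbr_unique[OF that(1,2) _ _ lm(3)] lm E_commute by blast
    have ne: "a \<noteq> c" "a \<noteq> d" "b \<noteq> c" "b \<noteq> d" using lm_u ab cd by blast+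
    have "card {p \<in> {a, b, c, d}. (p, x) \<in> I} \<le> 2" if "x \<in> L" for x
    proof -
      let ?B = "{p \<in> {a, b, c, d}. (p, x) \<in> I}"
      have on_x: "(p, x) \<in> I \<longleftrightarrow> (x, p) \<in> E" for p using that by (rule I_L)
      \<comment> \<open>The only line through \<open>a\<close> and \<open>b\<close> is
        \<open>l\<close>, which meets \<open>m\<close> in \<open>u\<close> alone.\<close>
      have "x = l" if "(x, a) \<in> E" "(x, b) \<in> E"
        using common_nbr_unique[of a x b l] that ab E_commute by blast
      hence ab_x: "(x, c) \<notin> E \<and> (x, d) \<notin> E" if "(x, a) \<in> E" "(x, b) \<in> E"
        using that lm_u cd by blast
      have "x = m" if "(x, c) \<in> E" "(x, d) \<in> E"
        using common_nbr_unique[of c x d m] that cd E_commute by blast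
      hence cd_x: "(x, a) \<notin> E \<and> (x, b) \<notin> E" if "(x, c) \<in> E" "(x, d) \<in> E"
        using that lm_u ab by blast
      \<comment> \<open>Either a whole pair lies on \<open>x\<close> and excludes the other pair, or
        at most one point of each pair lies on it.\<close>
      have "\<exists>y z. ?B \<subseteq> {y, z}"
      proof (cases "(x, a) \<in> E \<and> (x, b) \<in> E")
        case True
        then show ?thesis using ab_x unfolding on_x by blast
      next
        case ab: False
        show ?thesis
        proof (cases "(x, c) \<in> E \<and> (x, d) \<in> E")
          case True
          then show ?thesis using cd_x unfolding on_x by blast
        next
          case False
          then show ?thesis using ab unfolding on_x by blast
        qed
      qed
      then obtain y z where "?B \<subseteq> {y, z}" by blast
      hence "card ?B \<le> card {y, z}" by (intro card_mono) auto
      also have "\<dots> \<le> 2" by (simp add: card_insert_if)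
      finally show ?thesis .
    qed
    moreover have "{a, b, c, d} \<subseteq> P" using LP lmL ab cd by blast
    moreover have "card {a, b, c, d} = 4" using ab cd ne by simp
    ultimately show ?thesis by blast
  qed
  have plane: "projective_plane_of_order (k - 1) P L I"
    unfolding projective_plane_of_order_def projective_plane_def
    using join meet quad card_line by (intro conjI ballI impI) (auto simp: I_def)
  have U: "{v. near u v \<or> opposite u v} = P \<union> L" unfolding P_def L_def by blast
  let ?f = "\<lambda>v. if v \<in> P then Inl v else Inr v"
  have arcs: "E \<inter> (P \<union> L) \<times> (P \<union> L) = I \<union> I\<inverse>"
    using PL LP E_commute unfolding I_def by blast
  have fL: "?f l = Inr l" if "l \<in> L" for l using that disj by auto
  have "map_prod ?f ?f ` I = (\<lambda>(p, l). (Inl p, Inr l)) ` I"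
    by (intro image_cong refl) (auto simp: I_def fL)
  hence fI: "map_prod ?f ?f ` I = {(Inl p, Inr l) | p l. (p, l) \<in> I}" by auto
  have "map_prod ?f ?f ` (I\<inverse>) = (\<lambda>(l, p). (Inr l, Inl p)) ` (I\<inverse>)"
    by (intro image_cong refl) (auto simp: I_def fL)
  hence fI': "map_prod ?f ?f ` (I\<inverse>) = {(Inr l, Inl p) | p l. (p, l) \<in> I}" by auto
  have "digraph_iso (with_proj (component u)) (with_proj (incidence_graph P L I))"
  proof (rule digraph_iso_with_projI[of _ ?f])
    show "inj_on ?f (pverts (component u))"
      by (auto simp: inj_on_def)
    have "?f ` P = Inl ` P" by (intro image_cong) auto
    moreover have "?f ` L = Inr ` L" by (intro image_cong refl fL)
    ultimately show "pverts (incidence_graph P L I) = ?f ` pverts (component u)"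
      by (simp only: pverts_component U image_Un incidence_graph_def Plus_def pair_pre_digraph.simps)
    show "parcs (incidence_graph P L I) = map_prod ?f ?f ` parcs (component u)"
      unfolding parcs_component U arcs image_Un fI fI' by (simp add: incidence_graph_def)
  qed (simp add: pverts_component parcs_component)
  thus ?thesis using plane unfolding is_projective_plane_incidence_graph_def by blast
qed

text \<open>Two steps from \<open>u\<close> in both directions give the paths \<open>u, x, b\<close>
  and \<open>u, z, c\<close>. The ends are near each other, and their common neighbour
  \<open>y\<close> closes the hexagon.\<close>

lemma component_hexagon:
  assumes k: "k = 2" and u: "u \<in> V" and no_triangle: "\<And>w. (u, w) \<in> E \<Longrightarrow> \<not> near u w"
  shows "is_hexagon (component u)"
proof -
  have other: "\<exists>z. z \<noteq> y \<and> E `` {x} = {y, z}" if "(x, y) \<in> E" for x y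
  proof -
    have "card (E `` {x}) = 2" using card_nbrs that E_V k by blast
    then obtain p q where "E `` {x} = {p, q}" "p \<noteq> q" unfolding card_2_iff by blast
    moreover have "y \<in> E `` {x}" using that by simp
    ultimately show ?thesis by (metis insert_commute insert_iff singletonD)
  qed
  obtain x where ux: "(u, x) \<in> E" using nbr_exists[OF u] .
  obtain z where z: "z \<noteq> x" "E `` {u} = {x, z}" using other[OF ux] by blast
  have uz: "(u, z) \<in> E" using z by blast
  have xu: "(x, u) \<in> E" "(z, u) \<in> E" using ux uz E_commute by blast+
  obtain b where b: "b \<noteq> u" "E `` {x} = {u, b}" using other[OF xu(1)] by blast
  obtain c where c: "c \<noteq> u" "E `` {z} = {u, c}" using other[OF xu(2)] by blast
  have bx: "(b, x) \<in> E" and cz: "(c, z) \<in> E" using b c E_commute by blast+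
  \<comment> \<open>Otherwise \<open>u\<close> and \<open>b\<close> would have the two common
    neighbours \<open>x\<close> and \<open>z\<close>.\<close>
  have "b \<noteq> c"
    using common_nbr_unique[OF ux bx uz] cz b(1) z(1) by blast
  have "near u b" "near u c" using near_common ux bx uz cz by blast+
  hence "near b c" using near_sym near_trans by blast
  then obtain y where y: "(b, y) \<in> E" "(c, y) \<in> E" using \<open>b \<noteq> c\<close> unfolding near_def by blast
  have "y \<noteq> x" using y(2) b c(1) \<open>b \<noteq> c\<close> E_commute[of c x] by auto
  have "y \<noteq> z" using y(1) c b(1) \<open>b \<noteq> c\<close> E_commute[of b z] by auto
  have Eb: "E `` {b} = {x, y}" using other[OF bx] y(1) \<open>y \<noteq> x\<close> by auto
  have Ec: "E `` {c} = {z, y}" using other[OF cz] y(2) \<open>y \<noteq> z\<close> by auto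
  have Ey: "E `` {y} = {b, c}" using other[of y b] y E_commute \<open>b \<noteq> c\<close> by (metis Image_singleton_iff insert_iff singletonD)
  have opp: "opposite u x" "opposite u z" "opposite u y"
    using near_arc near_refl[OF u] ux uz \<open>near u b\<close> y(1) by blast+
  \<comment> \<open>Without an arc from \<open>u\<close> into its own class, the two classes are
    disjoint.\<close>
  have ne: "v \<noteq> w" if uv: "near u v" and uw: "opposite u w" for v w
  proof
    assume "v = w"
    obtain t where "(u, t) \<in> E" "near t w" using uw unfolding opposite_def by blast
    hence "near u t" using near_trans[OF uv] near_sym[of t w] \<open>v = w\<close> by blast
    thus False using no_triangle \<open>(u, t) \<in> E\<close> by blast
  qed
  have dist: "distinct [u, x, b, y, c, z]"
    using ne[OF near_refl[OF u]] ne[OF \<open>near u b\<close>] ne[OF \<open>near u c\<close>] opp z(1) b(1) c(1)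
      \<open>b \<noteq> c\<close> \<open>y \<noteq> x\<close> \<open>y \<noteq> z\<close> by auto
  \<comment> \<open>The reversed list supplies every inequation in the other orientation for the
    simplifier.\<close>
  hence dist': "distinct (rev [u, x, b, y, c, z])" by (simp only: distinct_rev)
  have near: "{v. near u v} = {u, b, c}"
  proof
    show "{v. near u v} \<subseteq> {u, b, c}"
    proof
      fix v assume "v \<in> {v. near u v}"
      hence "v = u \<or> (\<exists>t. (u, t) \<in> E \<and> (v, t) \<in> E)" unfolding near_def by blast
      hence "v = u \<or> v \<in> E `` (E `` {u})" using E_commute[of v] by blast
      moreover have "E `` (E `` {u}) = {u, b, c}" unfolding z(2) using b(2) c(2) by blast
      ultimately show "v \<in> {u, b, c}" by blast
    qed
  qed (use near_refl[OF u] \<open>near u b\<close> \<open>near u c\<close> in blast)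
  have opposite: "{v. opposite u v} = {x, y, z}"
  proof
    show "{v. opposite u v} \<subseteq> {x, y, z}"
    proof
      fix v assume "v \<in> {v. opposite u v}"
      hence v: "opposite u v" by simp
      obtain w where w: "(v, w) \<in> E" using nbr_exists opposite_V(2)[OF v] .
      hence "w \<in> {u, b, c}" using opposite_arc[OF v w] near by blast
      moreover have "v \<in> E `` {w}" using w E_commute by blast
      ultimately show "v \<in> {x, y, z}" using z(2) Eb Ec by blast
    qed
  qed (use opp in blast)
  define U where "U = {u, x, b, y, c, z}"
  have U: "{v. near u v \<or> opposite u v} = U" using near opposite unfolding U_def by blast
  \<comment> \<open>All six neighbourhoods are known, so the arcs of the component can be read
    off.\<close>
  have "E `` {v} \<subseteq> U" if "v \<in> U" for v
    using that z(2) b(2) c(2) Eb Ec Ey unfolding U_def by auto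
  hence "E \<inter> U \<times> U = (\<Union>v\<in>U. {v} \<times> E `` {v})" by blast
  also have "\<dots> = {u} \<times> {x, z} \<union> {x} \<times> {u, b} \<union> {b} \<times> {x, y} \<union> {y} \<times> {b, c} \<union> {c} \<times> {z, y} \<union> {z} \<times> {u, c}"
    unfolding U_def by (simp only: UN_insert UN_empty z(2) b(2) c(2) Eb Ec Ey) blast
  finally have arcs: "E \<inter> U \<times> U = {(u, x), (x, u), (x, b), (b, x), (b, y), (y, b), (y, c), (c, y),
      (c, z), (z, c), (z, u), (u, z)}"
    by auto
  let ?f = "\<lambda>v. if v = u then 0 else if v = x then 1 else if v = b then 2 else if v = y then 3
    else if v = c then 4 else 5 :: nat"
  show ?thesis unfolding is_hexagon_def
  proof (rule digraph_iso_with_projI[of _ ?f])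
    show "inj_on ?f (pverts (component u))"
      unfolding pverts_component U U_def using dist dist' by (simp add: inj_on_def)
    have "{..<6 :: nat} = {0, 1, 2, 3, 4, 5}" by auto
    thus "pverts (cycle_graph 6) = ?f ` pverts (component u)"
      unfolding pverts_component U U_def cycle_graph_def using dist dist' by (simp, blast)
    show "parcs (cycle_graph 6) = map_prod ?f ?f ` parcs (component u)"
      unfolding parcs_component U arcs parcs_cycle_graph_6 using dist dist' by simp
  qed (simp add: pverts_component parcs_component)
qed

end

section \<open>The energy bound and its extremal graphs\<close>

theorem theorem2p1:
  fixes k :: nat and G :: "'a pair_pre_digraph"
  assumes "k \<ge> 2"
    and "pair_graph G"
    and "pverts G \<noteq> {}"
    and "k_regular k G"
  shows "energy_per_vertex G
           \<le> (real k + ((real k)\<^sup>2 - real k) * sqrt (real k - 1)) / ((real k)\<^sup>2 - real k + 1) \<and>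
         (energy_per_vertex G
           = (real k + ((real k)\<^sup>2 - real k) * sqrt (real k - 1)) / ((real k)\<^sup>2 - real k + 1)
          \<longleftrightarrow> disjoint_union_of (is_projective_plane_incidence_graph (k - 1)) G \<or>
              (k = 2 \<and> disjoint_union_of (\<lambda>H. is_triangle H \<or> is_hexagon H) G))"
proof -
  interpret G: pair_graph G by fact
  \<comment> \<open>The enumeration chosen inside \<open>energy\<close>, named so that the spectral
    results apply to the very same matrix.\<close>
  define vs where "vs = (SOME vs. distinct vs \<and> set vs = pverts G)"
  have "\<exists>vs. distinct vs \<and> set vs = pverts G"
    using finite_distinct_list[OF G.pair_finite_verts] by blast
  hence vs: "distinct vs \<and> set vs = pverts G" unfolding vs_def by (rule someI_ex)
  interpret R: enumerated_regular_graph "pverts G" "parcs G" k vs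
  proof
    show "finite (pverts G)" by (rule G.pair_finite_verts)
    show "parcs G \<subseteq> pverts G \<times> pverts G" using G.arc_fst_in_verts G.arc_snd_in_verts by fastforce
    show "sym (parcs G)" using G.pair_sym_arcs unfolding symmetric_def by simp
    show "irrefl (parcs G)" using G.pair_no_loops unfolding irrefl_def by fastforce
    show "card (parcs G `` {v}) = k" if "v \<in> pverts G" for v
    proof -
      have "out_arcs (with_proj G) v = Pair v ` (parcs G `` {v})" by (auto simp: out_arcs_def)
      moreover have "card (out_arcs (with_proj G) v) = k"
        using assms(4) that unfolding k_regular_def out_degree_def by blast
      ultimately show ?thesis by (simp add: card_image inj_on_def)
    qed
  qed (use vs in auto)
  have "adjacency_matrix G vs = R.kernel_mat R.adj"
    unfolding adjacency_matrix_def R.kernel_mat_def R.adj_def by (intro eq_matI) auto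
  hence energy: "energy_per_vertex G = (\<Sum>\<mu>\<in>spectrum (R.kernel_mat R.adj).
      real (Polynomial.order \<mu> (char_poly (R.kernel_mat R.adj))) * cmod \<mu>) / real (card (pverts G))"
    unfolding energy_per_vertex_def energy_def vs_def[symmetric] by (simp add: Let_def)
  \<comment> \<open>By \<open>energy_bound\<close> and \<open>partial_plane_iff\<close>, equality
    amounts to \<open>partial_plane\<close>, so only this combinatorial equivalence remains.\<close>
  have "partial_plane (parcs G) \<longleftrightarrow>
    disjoint_union_of (is_projective_plane_incidence_graph (k - 1)) G \<or>
    (k = 2 \<and> disjoint_union_of (\<lambda>H. is_triangle H \<or> is_hexagon H) G)" (is "_ \<longleftrightarrow> ?planes \<or> _ \<and> ?cycles")
  proof
    assume "partial_plane (parcs G)"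
    then interpret P: partial_plane_graph "pverts G" "parcs G" k
      by unfold_locales (use assms(1) in simp)
    show "?planes \<or> k = 2 \<and> ?cycles"
    proof (cases "k = 2")
      case True
      \<comment> \<open>The component is a triangle if some arc from \<open>u\<close> ends near
        \<open>u\<close>, and a hexagon otherwise.\<close>
      have "is_triangle (P.component u) \<or> is_hexagon (P.component u)" if "u \<in> pverts G" for u
        using P.component_triangle P.component_hexagon[OF True that] by blast
      then show ?thesis using P.disjoint_union_of_components[of G] True by simp
    next
      case False
      then show ?thesis
        using P.disjoint_union_of_components[of G] P.component_projective_plane by simp
    qed
  next
    assume G: "?planes \<or> k = 2 \<and> ?cycles"
    have planes: "parcs H \<subseteq> pverts H \<times> pverts H \<and> partial_plane (parcs H)"
      if H: "is_projective_plane_incidence_graph (k - 1) H" for H :: "'a pair_pre_digraph"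
    proof -
      obtain P L :: "'a set" and I where plane: "projective_plane P L I"
        and iso: "digraph_iso (with_proj H) (with_proj (incidence_graph P L I))"
        using H unfolding is_projective_plane_incidence_graph_def projective_plane_of_order_def by blast
      show ?thesis
        using partial_plane_iso[OF iso partial_plane_incidence_graph[OF plane]]
          digraph_iso_with_projE[OF iso] by blast
    qed
    have cycles: "parcs H \<subseteq> pverts H \<times> pverts H \<and> partial_plane (parcs H)"
      if H: "is_triangle H \<or> is_hexagon H" for H :: "'a pair_pre_digraph"
    proof -
      obtain n where n: "n = 3 \<or> n = 6" and iso: "digraph_iso (with_proj H) (with_proj (cycle_graph n))"
        using H unfolding is_triangle_def is_hexagon_def by blast
      have "partial_plane (parcs (cycle_graph n))"
        using n partial_plane_cycle_graph_3 partial_plane_cycle_graph_6 by blast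
      thus ?thesis using partial_plane_iso[OF iso] digraph_iso_with_projE[OF iso] by blast
    qed
    show "partial_plane (parcs G)"
      using G partial_plane_disjoint_union[OF _ planes] partial_plane_disjoint_union[OF _ cycles] by blast
  qed
  thus ?thesis
    using R.energy_bound[OF assms(1,3) energy refl] unfolding R.partial_plane_iff by simp
qed

end
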